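(* Let $k$ be an algebraically closed field of characteristic $2$, let $n\ge2$ and let $G=Q_{2^{n+1}}$ be the generalized quaternion group of order $2^{n+1}$. Let $\phi$ be a simple $G$-action over $k$. Then $\phi$ does not lift to characteristic zero.
   Context: $G=Q_{2^{n+1}}=\langle\sigma,\tau\mid\tau^{2^n}=1,\ \tau^{2^{n-1}}=\sigma^2,\ \sigma\tau\sigma^{-1}=\tau^{-1}\rangle$. Set $H_0=\langle\tau\rangle$, $H_1=\langle\sigma\rangle$, $H_2=\langle\sigma\tau\rangle$. For $i=0,1,2$ let $\chi_i:G\to\{\pm1\}$ be the unique character of order $2$ with $H_i\subset\mathrm{Ker}(\chi_i)$. A local $G$-action over $k$ is a faithful $k$-linear action $\phi:G\hookrightarrow\mathrm{Aut}_k(k[[z]])$ on a ring of formal power series in one variable. It lifts to characteristic zero if there are a discrete valuation ring $R$ of characteristic zero with residue field $k$ and an action $\phi_R:G\hookrightarrow\mathrm{Aut}_R(R[[z]])$ reducing to $\phi$. The Artin character $a_\phi$ is the character of $G$ with $a_\phi(g)=-\mathrm{ord}_z(g(z)-z)$ for $g\ne1$ and $a_\phi(1)=-\sum_{g\neq1}a_\phi(g)$. For a character $\chi$ of $G$ we write $a_\phi(\chi):=\langle\chi,a_\phi\rangle_G=|G|^{-1}\sum_{g\in G}\overline{\chi(g)}\,a_\phi(g)$. A local $G$-action $\phi$ is called simple if $a_\phi(\chi_0)=2$ and $a_\phi(\chi_1)=a_\phi(\chi_2)\ge2$. *)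

theory Defs
  imports
    Complex_Main
    "HOL-Algebra.Generated_Groups"
    "HOL-Algebra.Group_Action"
    "HOL-Algebra.Ring_Divisibility"
    "HOL-Algebra.Algebraic_Closure_Type"
    "HOL-Computational_Algebra.Formal_Power_Series"
begin

section \<open>The generalized quaternion group\<close>

text \<open>
  The relations let every product of generators be rewritten as \<open>\<tau>\<^sup>a \<sigma>\<^sup>b\<close> with
  \<open>a < 2 ^ n\<close> and \<open>b < 2\<close>, so a group generated by elements satisfying them is a quotient of the
  presented group, which has order \<open>2 ^ (n + 1)\<close>. The condition on the order
  says that no further relations hold, i.e. that \<open>G\<close> is the presented group.
\<close>

locale generalized_quaternion = group G for G (structure) +
  fixes \<sigma> \<tau> and n :: nat
  assumes \<sigma>_closed: "\<sigma> \<in> carrier G"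
    and \<tau>_closed: "\<tau> \<in> carrier G"
    and generated: "generate G {\<sigma>, \<tau>} = carrier G"
    and \<tau>_pow: "\<tau> [^] ((2::nat) ^ n) = \<one>"
    and \<tau>_pow_half: "\<tau> [^] ((2::nat) ^ (n - 1)) = \<sigma> [^] (2::nat)"
    and conj_\<tau>: "\<sigma> \<otimes> \<tau> \<otimes> inv \<sigma> = inv \<tau>"
    and order_eq: "Coset.order G = 2 ^ (n + 1)"

section \<open>Actions on formal power series\<close>

text \<open>
  No continuity is required: the automorphisms are all \<open>A\<close>-algebra automorphisms of \<open>A[[z]]\<close>.
\<close>

definition fps_algebra_aut :: "('a::comm_ring_1 fps \<Rightarrow> 'a fps) \<Rightarrow> bool" where
  "fps_algebra_aut f \<longleftrightarrow>
     f \<in> ring_hom ring_of_type_algebra ring_of_type_algebra \<and> bij f \<and>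
     (\<forall>c. f (fps_const c) = fps_const c)"

definition fps_action ::
  "('g, 'm) monoid_scheme \<Rightarrow> ('g \<Rightarrow> 'a::comm_ring_1 fps \<Rightarrow> 'a fps) \<Rightarrow> bool" where
  "fps_action G \<phi> \<longleftrightarrow>
     faithful_action G UNIV \<phi> \<and> (\<forall>g\<in>carrier G. fps_algebra_aut (\<phi> g))"

section \<open>Lifting to characteristic zero\<close>

definition discrete_valuation_ring :: "('r, 'm) ring_scheme \<Rightarrow> bool" where
  "discrete_valuation_ring R \<longleftrightarrow>
     principal_domain R \<and> (\<exists>!P. primeideal P R \<and> P \<noteq> {\<zero>\<^bsub>R\<^esub>})"

definition fps_reduce :: "('r::zero \<Rightarrow> 'k) \<Rightarrow> 'r fps \<Rightarrow> 'k fps" where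
  "fps_reduce \<pi> f = Abs_fps (\<lambda>i. \<pi> (fps_nth f i))"

text \<open>
  The ring \<open>R\<close> is the type \<open>'r\<close>. A surjective ring homomorphism \<open>\<pi>\<close> onto the
  field \<open>'k\<close> identifies the residue field with \<open>'k\<close>: its kernel is a maximal ideal, and a
  discrete valuation ring has only one. Quantifying over all
  types \<open>'r\<close> amounts to quantifying over all \<open>R\<close>.
\<close>

definition lifts_over ::
  "'r::idom itself \<Rightarrow> ('g, 'm) monoid_scheme \<Rightarrow> ('g \<Rightarrow> 'k::field fps \<Rightarrow> 'k fps) \<Rightarrow> bool" where
  "lifts_over R G \<phi> \<longleftrightarrow>
     discrete_valuation_ring (ring_of_type_algebra :: 'r ring) \<and> CHAR('r) = 0 \<and>
     (\<exists>(\<pi> :: 'r \<Rightarrow> 'k) (\<phi>\<^sub>R :: 'g \<Rightarrow> 'r fps \<Rightarrow> 'r fps).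
        \<pi> \<in> ring_hom ring_of_type_algebra ring_of_type_algebra \<and> surj \<pi> \<and>
        fps_action G \<phi>\<^sub>R \<and>
        (\<forall>g\<in>carrier G. \<forall>f. fps_reduce \<pi> (\<phi>\<^sub>R g f) = \<phi> g (fps_reduce \<pi> f)))"

section \<open>The Artin character and simple actions\<close>

text \<open>
  \<open>subdegree 0 = 0\<close> does not interfere: a nontrivial automorphism of \<open>k[[z]]\<close> over a field \<open>k\<close>
  moves \<open>z\<close>.
\<close>

definition artin_char ::
  "('g, 'm) monoid_scheme \<Rightarrow> ('g \<Rightarrow> 'k::field fps \<Rightarrow> 'k fps) \<Rightarrow> 'g \<Rightarrow> int" where
  "artin_char G \<phi> g =
     (let a = (\<lambda>h. - int (subdegree (\<phi> h fps_X - fps_X)))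
      in if g = \<one>\<^bsub>G\<^esub> then - (\<Sum>h\<in>carrier G - {\<one>\<^bsub>G\<^esub>}. a h) else a g)"

definition artin_pairing ::
  "('g, 'm) monoid_scheme \<Rightarrow> ('g \<Rightarrow> 'k::field fps \<Rightarrow> 'k fps) \<Rightarrow> ('g \<Rightarrow> complex) \<Rightarrow> complex" where
  "artin_pairing G \<phi> \<chi> =
     (\<Sum>g\<in>carrier G. cnj (\<chi> g) * of_int (artin_char G \<phi> g)) / of_nat (Coset.order G)"

definition order_two_character :: "('g, 'm) monoid_scheme \<Rightarrow> ('g \<Rightarrow> complex) \<Rightarrow> bool" where
  "order_two_character G \<chi> \<longleftrightarrow>
     (\<forall>g\<in>carrier G. \<chi> g \<in> {1, -1}) \<and>
     (\<forall>g\<in>carrier G. \<forall>h\<in>carrier G. \<chi> (g \<otimes>\<^bsub>G\<^esub> h) = \<chi> g * \<chi> h) \<and>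
     (\<exists>g\<in>carrier G. \<chi> g \<noteq> 1)"

definition character_kernel :: "('g, 'm) monoid_scheme \<Rightarrow> ('g \<Rightarrow> complex) \<Rightarrow> 'g set" where
  "character_kernel G \<chi> = {g \<in> carrier G. \<chi> g = 1}"

text \<open>
  For a generalized quaternion group with \<open>n \<ge> 2\<close>, each of the three characters exists and its
  values on \<open>carrier G\<close>, the only ones that the pairing sees, are determined uniquely. The pairings
  with them are real (even rational), so \<open>Re\<close> only serves to state the inequality.
\<close>

definition simple_action ::
  "('g, 'm) monoid_scheme \<Rightarrow> 'g \<Rightarrow> 'g \<Rightarrow> ('g \<Rightarrow> 'k::field fps \<Rightarrow> 'k fps) \<Rightarrow> bool" where
  "simple_action G \<sigma> \<tau> \<phi> \<longleftrightarrow>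
     fps_action G \<phi> \<and>
     (\<exists>\<chi>\<^sub>0 \<chi>\<^sub>1 \<chi>\<^sub>2.
        order_two_character G \<chi>\<^sub>0 \<and> generate G {\<tau>} \<subseteq> character_kernel G \<chi>\<^sub>0 \<and>
        order_two_character G \<chi>\<^sub>1 \<and> generate G {\<sigma>} \<subseteq> character_kernel G \<chi>\<^sub>1 \<and>
        order_two_character G \<chi>\<^sub>2 \<and> generate G {\<sigma> \<otimes>\<^bsub>G\<^esub> \<tau>} \<subseteq> character_kernel G \<chi>\<^sub>2 \<and>
        artin_pairing G \<phi> \<chi>\<^sub>0 = 2 \<and>
        artin_pairing G \<phi> \<chi>\<^sub>1 = artin_pairing G \<phi> \<chi>\<^sub>2 \<and>
        Re (artin_pairing G \<phi> \<chi>\<^sub>1) \<ge> 2)"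

end

theory Submission
  imports Defs
begin

text \<open>
  Suppose that \<open>\<phi>\<close> lifts. Simplicity forces
  \<open>ord\<^sub>z(\<sigma>(z) - z) = 2\<close>, so over \<open>R\<close> the fixed locus of \<open>\<sigma>\<close> consists of
  the two zeros of a quadratic \<open>P = z\<^sup>2 - a z + b\<close>. The element \<open>\<rho> = \<tau>\<^sup>q\<close> with
  \<open>q = 2\<^sup>n\<^sup>-\<^sup>2\<close> generates a quaternion group of order \<open>8\<close> together with \<open>\<sigma>\<close>. In
  characteristic zero stabilizers are cyclic, so \<open>\<rho>\<close> and \<open>\<rho>\<sigma>\<close> exchange the two zeros, and
  \<open>\<rho>(z) - z\<close> and \<open>\<rho>\<sigma>(z) - z\<close> are both congruent to \<open>a - 2 z\<close> modulo \<open>P\<close>.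
  The derivative of \<open>\<sigma>\<close> at the zeros of \<open>P\<close> is a square root of \<open>-1\<close>, and a computation with it
  shows that \<open>\<sigma>\<^sup>2(z) - z\<close> divided by \<open>P\<close> is also congruent to \<open>a - 2 z\<close> modulo \<open>P\<close>, up to
  a unit. Hence \<open>\<sigma>\<^sup>2(z) - z\<close> is \<open>P (\<rho>(z) - z)\<close> and also
  \<open>P (\<rho>\<sigma>(z) - z)\<close>, up to units. Thus \<open>\<rho>\<close> and \<open>\<rho>\<sigma>\<close>, and
  therefore \<open>\<sigma>\<close>, fix the zeros of \<open>\<rho>(z) - z\<close>; but these are not zeros of \<open>P\<close>.
\<close>

section \<open>Congruences and pairs of endomorphisms generating a quaternion group\<close>

locale ring_endo =
  fixes g :: "'a::comm_ring_1 \<Rightarrow> 'a"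
  assumes hom_add: "g (a + b) = g a + g b"
    and hom_mult: "g (a * b) = g a * g b"
    and hom_one: "g 1 = 1"
begin

lemma hom_zero: "g 0 = 0"
  using hom_add[of 0 0] by simp

lemma hom_uminus: "g (- a) = - g a"
  using hom_add[of a "- a"] by (simp add: hom_zero eq_neg_iff_add_eq_0 add.commute)

lemma hom_diff: "g (a - b) = g a - g b"
  using hom_add[of a "- b"] by (simp add: hom_uminus)

lemma hom_power: "g (a ^ n) = g a ^ n"
  by (induction n) (simp_all add: hom_one hom_mult)

lemma hom_sum: "g (sum h S) = (\<Sum>x\<in>S. g (h x))"
  by (induction S rule: infinite_finite_induct) (simp_all add: hom_zero hom_add)

lemma hom_dvd: "a dvd b \<Longrightarrow> g a dvd g b"
  by (metis dvd_def hom_mult)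

lemma hom_numeral: "g (numeral k) = numeral k"
proof -
  have "g (of_nat n) = of_nat n" for n
    by (induction n) (simp_all add: hom_zero hom_add hom_one)
  from this[of "numeral k"] show ?thesis by simp
qed

lemmas homs = hom_zero hom_one hom_add hom_diff hom_uminus hom_mult hom_power hom_numeral

end

definition eqmod :: "'a::comm_ring_1 \<Rightarrow> 'a \<Rightarrow> 'a \<Rightarrow> bool" where
  "eqmod P a b \<longleftrightarrow> P dvd a - b"

lemma eqmod_refl: "eqmod P a a"
  by (simp add: eqmod_def)

lemma eqmod_sym: "eqmod P a b \<Longrightarrow> eqmod P b a"
  unfolding eqmod_def by (metis dvd_minus_iff minus_diff_eq)

lemma eqmod_trans [trans]: "eqmod P a b \<Longrightarrow> eqmod P b c \<Longrightarrow> eqmod P a c"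
  unfolding eqmod_def using dvd_add[of P "a - b" "b - c"] by simp

lemma eqmod_add: "eqmod P a b \<Longrightarrow> eqmod P c d \<Longrightarrow> eqmod P (a + c) (b + d)"
  unfolding eqmod_def using dvd_add[of P "a - b" "c - d"] by (simp add: algebra_simps)

lemma eqmod_diff: "eqmod P a b \<Longrightarrow> eqmod P c d \<Longrightarrow> eqmod P (a - c) (b - d)"
  unfolding eqmod_def using dvd_diff[of P "a - b" "c - d"] by (simp add: algebra_simps)

lemma eqmod_mult: "eqmod P a b \<Longrightarrow> eqmod P c d \<Longrightarrow> eqmod P (a * c) (b * d)"
  unfolding eqmod_def
proof -
  assume "P dvd a - b" "P dvd c - d"
  hence "P dvd (a - b) * c + b * (c - d)"
    by (intro dvd_add dvd_mult dvd_mult2)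
  thus "P dvd a * c - b * d" by (simp add: algebra_simps)
qed

lemma eqmod_0_iff: "eqmod P a 0 \<longleftrightarrow> P dvd a"
  by (simp add: eqmod_def)

lemma eqmod_unit_cancel:
  assumes "v dvd 1" "eqmod P (v * a) (v * b)"
  shows "eqmod P a b"
proof -
  obtain w where w: "1 = v * w" using assms(1) by (auto elim: dvdE)
  have "eqmod P (w * (v * a)) (w * (v * b))"
    by (intro eqmod_mult eqmod_refl assms(2))
  moreover have "w * (v * c) = c" for c
    by (metis w mult.assoc mult.commute mult_1)
  ultimately show ?thesis by simp
qed

text \<open>The relations are those of the quaternion group of order 8, with the cube of
  \<open>s\<close> in place of its inverse. Nontriviality is imposed separately, for example by
  \<open>R_ss\<close>.\<close>

locale quaternion_endos = s: ring_endo s + r: ring_endo r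
  for s r :: "'a::idom \<Rightarrow> 'a" +
  assumes rr: "r (r f) = s (s f)"
    and ssss: "s (s (s (s f))) = f"
    and rs: "r (s f) = s (s (s (r f)))"
begin

text \<open>The relations are symmetric in \<open>r\<close> and \<open>r s\<close>, so every result
  about \<open>r\<close> can be applied to \<open>r s\<close> too; \<open>no_lift\<close> compares
  the two.\<close>

lemma rotate: "quaternion_endos s (\<lambda>f. r (s f))"
  by unfold_locales (simp_all add: s.homs r.homs rr ssss rs)

lemma ss_r: "r (s (s f)) = s (s (r f))"
  using rr[of "r f"] rr[of f] by simp

text \<open>Such anti-invariant elements, with \<open>a\<close> the variable, serve as
  \<open>F\<close> in the lemmas below.\<close>

lemma ss_neg: "s (s (s (s a) - a)) = - (s (s a) - a)"
  by (simp add: s.homs ssss)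

text \<open>The fourth power of \<open>g\<close> is the identity, so the product of the four
  successive images of \<open>c\<close> under \<open>g\<close> is 1.\<close>

lemma semi_invariant_unit:
  assumes "P \<noteq> 0" "g \<in> {s, r}" "g P = c * P"
  shows "c dvd 1"
proof -
  have "g (g (g (g P))) = P"
    using assms(2) ssss rr by auto
  moreover have "g (a * b) = g a * g b" for a b
    using assms(2) s.hom_mult r.hom_mult by auto
  ultimately have "c * (g (g (g c)) * g (g c) * g c) * P = 1 * P"
    by (simp add: assms(3) mult_ac)
  hence "c * (g (g (g c)) * g (g c) * g c) = 1"
    using assms(1) mult_right_cancel by blast
  thus ?thesis by (metis dvd_triv_left)
qed

text \<open>The square of \<open>s\<close> acts by \<open>-1\<close> on \<open>F\<close>, but trivially on
  \<open>(P\<^sup>k) / (P\<^sup>k\<^sup>+\<^sup>1)\<close>; so \<open>F\<close> lies in every power of \<open>(P)\<close>.\<close>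

lemma ss_not_unipotent:
  assumes triv: "\<And>f. eqmod P (s f) f"
    and tors: "\<And>f. P dvd 2 * f \<Longrightarrow> P dvd f"
    and F: "s (s F) = - F" "\<not> P ^ N dvd F"
    and c: "s (s P) = c * P" "eqmod P c 1"
  shows False
proof -
  have "P ^ k dvd F" for k
  proof (induction k)
    case 0
    show ?case by simp
  next
    case (Suc k)
    then obtain h where h: "F = P ^ k * h" by (auto elim: dvdE)
    have ck: "eqmod P (c ^ k) 1"
      by (induction k) (use eqmod_mult[OF c(2)] in \<open>auto simp: eqmod_refl\<close>)
    have "eqmod P (s (s h)) h"
      using eqmod_trans triv by blast
    from eqmod_mult[OF ck this] have "P dvd c ^ k * s (s h) - h"
      by (simp add: eqmod_def)
    \<comment> \<open>Cancelling \<open>P ^ k\<close> from \<open>s (s F) = - F\<close> gives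
      \<open>c ^ k * s (s h) = - h\<close>, whose left side is also congruent to
      \<open>h\<close>.\<close>
    hence "P dvd 2 * h" if "P ^ k \<noteq> 0"
    proof -
      have "- (P ^ k * h) = P ^ k * (c ^ k * s (s h))"
        using F(1) by (simp add: h s.homs c(1) power_mult_distrib mult_ac)
      hence "P ^ k * (- h) = P ^ k * (c ^ k * s (s h))" by simp
      hence e: "c ^ k * s (s h) = - h" using that mult_left_cancel by metis
      have "P dvd - (c ^ k * s (s h) - h)"
        using \<open>P dvd c ^ k * s (s h) - h\<close> by (simp only: dvd_minus_iff)
      thus ?thesis by (simp add: e)
    qed
    hence "P ^ k \<noteq> 0 \<Longrightarrow> P dvd h" using tors by blast
    thus ?case using h by (cases "P ^ k = 0") (auto simp: mult.commute mult_dvd_mono)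
  qed
  thus False using F(2) by blast
qed

text \<open>On \<open>(P) / (P\<^sup>2)\<close> both \<open>s\<close> and \<open>r\<close> act by scalars, hence commute, so the
  commutator \<open>s\<^sup>2\<close> acts trivially there.\<close>

lemma no_common_fixed_locus:
  assumes "P \<noteq> 0"
    and triv: "\<And>f. eqmod P (s f) f" "\<And>f. eqmod P (r f) f"
    and tors: "\<And>f. P dvd 2 * f \<Longrightarrow> P dvd f"
    and F: "s (s F) = - F" "\<not> P ^ N dvd F"
  shows False
proof -
  have stab: "P dvd a" if "eqmod P a P" for a
    using dvd_add[OF that[unfolded eqmod_def] dvd_refl] by simp
  obtain \<theta> where \<theta>: "s P = \<theta> * P"
    using stab[OF triv(1)[of P]] by (metis dvdE mult.commute)
  obtain v where v: "r P = v * P"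
    using stab[OF triv(2)[of P]] by (metis dvdE mult.commute)
  have ss: "eqmod P (s (s f)) f" for f
    using eqmod_trans triv(1) by blast
  \<comment> \<open>Both sides are \<open>r (s P)\<close>, expanded by the two sides of
    \<open>rs\<close>. Modulo \<open>P\<close> the maps disappear, and what remains is that the
    multiplier \<open>s \<theta> * \<theta>\<close> of \<open>s^2\<close> is congruent to 1.\<close>
  have "r \<theta> * v * P = s (s (s v * \<theta>)) * (s \<theta> * \<theta>) * P"
    using rs[of P] by (simp add: \<theta> v s.homs r.homs mult_ac)
  hence eq: "r \<theta> * v = s (s (s v * \<theta>)) * (s \<theta> * \<theta>)"
    using \<open>P \<noteq> 0\<close> mult_right_cancel by blast
  have "eqmod P (\<theta> * v * 1) (r \<theta> * v)"
    by (simp, intro eqmod_mult eqmod_refl eqmod_sym[OF triv(2)])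
  also have "eqmod P \<dots> (v * \<theta> * (s \<theta> * \<theta>))"
    unfolding eq using eqmod_trans[OF ss eqmod_mult[OF triv(1) eqmod_refl]]
    by (intro eqmod_mult eqmod_refl)
  finally have "eqmod P (\<theta> * v * 1) (\<theta> * v * (s \<theta> * \<theta>))"
    by (simp add: mult_ac)
  moreover have "\<theta> * v dvd 1"
    using mult_dvd_mono[of \<theta> 1 v 1] semi_invariant_unit[of P s \<theta>] semi_invariant_unit[of P r v]
      \<open>P \<noteq> 0\<close> \<theta> v by simp
  ultimately have "eqmod P (s \<theta> * \<theta>) 1"
    using eqmod_unit_cancel eqmod_sym by blast
  moreover have "s (s P) = s \<theta> * \<theta> * P"
    by (simp add: \<theta> s.homs mult_ac)
  ultimately show False
    using ss_not_unipotent[OF triv(1) tors F] by blast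
qed

end

section \<open>Weierstrass division\<close>

lemma fps_const_dvd_iff: "fps_const c dvd f \<longleftrightarrow> (\<forall>k. (c::'a::comm_ring_1) dvd f $ k)"
proof
  assume "\<forall>k. c dvd f $ k"
  hence "\<forall>k. \<exists>h. f $ k = c * h" by (simp add: dvd_def)
  then obtain h where "\<And>k. f $ k = c * h k" by metis
  hence "f = fps_const c * Abs_fps h" by (simp add: fps_eq_iff)
  thus "fps_const c dvd f" by simp
qed (auto elim!: dvdE)

lemma fps_unitI:
  fixes f :: "'a::comm_ring_1 fps"
  assumes "f $ 0 dvd 1"
  shows "f dvd 1"
proof -
  obtain y where "f $ 0 * y = 1" using assms by (metis dvdE)
  from fps_right_inverse[OF this] show ?thesis by (metis dvd_triv_left)
qed

lemma fps_X_power_dvdI: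
  assumes "\<And>k. k < n \<Longrightarrow> f $ k = 0"
  shows "fps_X ^ n dvd (f :: 'a::comm_ring_1 fps)"
proof -
  have "f = fps_X ^ n * fps_shift n f"
    using assms by (auto simp: fps_eq_iff fps_X_power_mult_nth)
  thus ?thesis by (metis dvd_triv_left)
qed

lemma power_diff_dvd: "(a - b) dvd (a ^ n - b ^ n :: 'a::comm_ring_1)"
  by (simp add: power_diff_sumr2)

locale fps_endo = ring_endo g for g :: "'a::comm_ring_1 fps \<Rightarrow> 'a fps" +
  assumes hom_const: "g (fps_const c) = fps_const c"
begin

text \<open>Each \<open>g z^k - z^k\<close> is a multiple of \<open>g z - z\<close>. Since
  \<open>g\<close> need not commute with infinite sums, this covers polynomials only;
  \<open>disp_dvd\<close> extends it by Weierstrass division.\<close>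

lemma disp_dvd_poly:
  assumes "\<And>n. n \<ge> d \<Longrightarrow> p $ n = 0"
  shows "(g fps_X - fps_X) dvd (g p - p)"
proof -
  have p: "p = (\<Sum>k<d. fps_const (p $ k) * fps_X ^ k)"
    using assms by (auto simp: fps_eq_iff fps_sum_nth not_less if_distrib cong: if_cong)
  have "g p - p = (\<Sum>k<d. fps_const (p $ k) * (g fps_X ^ k - fps_X ^ k))"
    by (subst (1 2) p) (simp add: hom_sum homs hom_const sum_subtractf algebra_simps)
  thus ?thesis by (simp add: dvd_sum dvd_mult power_diff_dvd)
qed

end

text \<open>What is used of a discrete valuation ring with uniformizer \<open>p\<close> and residue
  map \<open>red\<close>: the kernel is generated by \<open>p\<close>, everything outside it is a
  unit, and the \<open>p\<close>-adic topology is separated.\<close>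

locale residue_hom =
  fixes red :: "'r::idom \<Rightarrow> 'k::field" and p :: 'r
  assumes red_add: "red (a + b) = red a + red b"
    and red_mult: "red (a * b) = red a * red b"
    and red_one: "red 1 = 1"
    and red_eq_0_iff: "red a = 0 \<longleftrightarrow> p dvd a"
    and unitI: "red a \<noteq> 0 \<Longrightarrow> a dvd 1"
    and separated: "(\<And>n. p ^ n dvd a) \<Longrightarrow> a = 0"
    and two_nonzero: "(2::'r) \<noteq> 0"
begin

abbreviation R :: "'r fps \<Rightarrow> 'k fps" where "R \<equiv> fps_reduce red"

lemma R_nth: "R f $ k = red (f $ k)"
  by (simp add: fps_reduce_def)

lemma red_zero: "red 0 = 0"
  by (simp add: red_eq_0_iff)

lemma red_uminus: "red (- a) = - red a"
  using red_add[of a "- a"] by (simp add: red_zero eq_neg_iff_add_eq_0 add.commute)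

lemma red_sum: "red (sum h S) = (\<Sum>x\<in>S. red (h x))"
  by (induction S rule: infinite_finite_induct) (simp_all add: red_zero red_add)

lemma R_add: "R (f + g) = R f + R g"
  by (simp add: fps_eq_iff R_nth red_add)

lemma R_diff: "R (f - g) = R f - R g"
  using red_add[of _ "- _"] by (simp add: fps_eq_iff R_nth red_uminus flip: add_uminus_conv_diff)

lemma R_mult: "R (f * g) = R f * R g"
  by (simp add: fps_eq_iff R_nth fps_mult_nth red_sum red_mult)

lemma R_one: "R 1 = 1"
  by (simp add: fps_eq_iff R_nth red_one red_zero)

lemma R_zero: "R 0 = 0"
  by (simp add: fps_eq_iff R_nth red_zero)

lemma R_X: "R fps_X = fps_X"
  by (simp add: fps_eq_iff R_nth red_one red_zero fps_X_def)

lemma R_power: "R (f ^ n) = R f ^ n"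
  by (induction n) (simp_all add: R_one R_mult)

lemma R_dvd: "f dvd g \<Longrightarrow> R f dvd R g"
  by (metis dvd_def R_mult)

lemma fps_unit_iff: "f dvd 1 \<longleftrightarrow> red (f $ 0) \<noteq> 0"
proof
  assume "f dvd 1"
  from R_dvd[OF this] show "red (f $ 0) \<noteq> 0" by (simp add: R_one R_nth)
next
  assume "red (f $ 0) \<noteq> 0"
  thus "f dvd 1" by (intro fps_unitI unitI)
qed

lemma fps_separated: "(\<And>n. fps_const (p ^ n) dvd f) \<Longrightarrow> f = 0"
  unfolding fps_const_dvd_iff by (rule fps_ext, subst fps_zero_nth, rule separated) blast

end

text \<open>Completeness is not part of the given data; \<open>complete_of_endo\<close> extracts it
  from an endomorphism that moves the origin.\<close>

locale complete_residue_hom = residue_hom +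
  assumes complete: "(\<And>n. p ^ n dvd x (Suc n) - x n) \<Longrightarrow> \<exists>l. \<forall>n. p ^ n dvd l - x n"
begin

lemma fps_complete:
  assumes "\<And>n. fps_const (p ^ n) dvd x (Suc n) - x n"
  shows "\<exists>l. \<forall>n. fps_const (p ^ n) dvd l - x n"
proof -
  have "\<exists>l. \<forall>n. p ^ n dvd l - x n $ k" for k
    using assms by (intro complete) (auto simp: fps_const_dvd_iff)
  then obtain l where "\<And>k n. p ^ n dvd l k - x n $ k" by metis
  thus ?thesis by (intro exI[of _ "Abs_fps l"]) (simp add: fps_const_dvd_iff)
qed

text \<open>The contraction principle for the \<open>p\<close>-adic topology: the iterates of
  \<open>T\<close> starting at 0 converge.\<close>

lemma fps_fixed_point:
  assumes "\<And>n f g. fps_const (p ^ n) dvd f - g \<Longrightarrow> fps_const (p ^ Suc n) dvd T f - T g"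
  shows "\<exists>f. T f = f"
proof -
  define x where "x n = (T ^^ n) 0" for n
  have "fps_const (p ^ n) dvd x (Suc n) - x n" for n
    by (induction n) (use assms in \<open>simp_all add: x_def\<close>)
  from fps_complete[OF this] obtain l where l: "\<And>n. fps_const (p ^ n) dvd l - x n" by blast
  have "fps_const (p ^ n) dvd T l - l" for n
  proof -
    have "fps_const (p ^ Suc n) dvd (T l - T (x n)) - (l - x (Suc n))"
      by (intro dvd_diff assms l)
    hence "fps_const (p ^ Suc n) dvd T l - l" by (simp add: x_def)
    moreover have "fps_const (p ^ n) dvd fps_const (p ^ Suc n)"
      by (simp add: fps_const_dvd_iff)
    ultimately show ?thesis by (rule dvd_trans[rotated])
  qed
  from fps_separated[OF this] show ?thesis by auto
qed

text \<open>Write \<open>F = L + z\<^sup>d H\<close> with \<open>L\<close> divisible by \<open>p\<close> and \<open>H\<close> a unit. Then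
  \<open>f - q F\<close> has degree less than \<open>d\<close> iff \<open>q H\<close> is a fixed point of a
  contraction.\<close>

lemma weierstrass_division:
  assumes F: "R F \<noteq> 0"
  shows "\<exists>q r. f = q * F + r \<and> (\<forall>n\<ge>subdegree (R F). r $ n = 0)"
proof -
  define d where "d = subdegree (R F)"
  have decomp: "F = fps_shift d F * fps_X ^ d + fps_cutoff d F"
    by (simp add: fps_shift_cutoff)
  have low: "red (F $ k) = 0" if "k < d" for k
    using that nth_less_subdegree_zero[of k "R F"] by (simp add: d_def R_nth)
  have "fps_const p dvd fps_cutoff d F"
    unfolding fps_const_dvd_iff using low by (simp add: red_eq_0_iff)
  then obtain L where L: "fps_cutoff d F = fps_const p * L" by (auto elim: dvdE)
  have "fps_shift d F dvd 1"
    using nth_subdegree_nonzero[OF F] by (simp add: fps_unit_iff d_def R_nth)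
  then obtain U where U: "fps_shift d F * U = 1" by (metis dvdE)
  \<comment> \<open>\<open>Q\<close> stands for the quotient times the unit
    \<open>fps_shift d F\<close>. The equation \<open>T Q = Q\<close> says that
    \<open>f - Q * U * F\<close> has no terms of degree \<open>d\<close> or more.\<close>
  define T where "T Q = fps_shift d f - fps_shift d (Q * U * fps_cutoff d F)" for Q
  have "fps_const (p ^ Suc n) dvd T Q1 - T Q2" if Q: "fps_const (p ^ n) dvd Q1 - Q2" for n Q1 Q2
  proof -
    obtain h where h: "Q1 - Q2 = fps_const (p ^ n) * h" using Q by (rule dvdE)
    have "T Q1 - T Q2 = - fps_shift d ((Q1 - Q2) * U * fps_cutoff d F)"
      by (simp add: T_def fps_eq_iff algebra_simps)
    also have "(Q1 - Q2) * U * fps_cutoff d F = fps_const (p ^ Suc n) * (h * U * L)"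
      by (simp add: h L mult_ac flip: fps_const_mult)
    finally show ?thesis by (simp add: fps_const_dvd_iff)
  qed
  from fps_fixed_point[of T, OF this] obtain Q where Q: "T Q = Q" by blast
  have "Q * U * F = Q * (fps_shift d F * U) * fps_X ^ d + Q * U * fps_cutoff d F"
    by (subst decomp) (simp add: algebra_simps)
  hence "fps_shift d (Q * U * F) = Q + fps_shift d (Q * U * fps_cutoff d F)"
    by (simp add: U fps_eq_iff fps_X_power_mult_right_nth)
  also have "\<dots> = fps_shift d f"
    using Q by (simp add: T_def algebra_simps)
  finally have "fps_shift d (f - Q * U * F) = 0" by (simp add: fps_eq_iff)
  hence "\<forall>n\<ge>d. (f - Q * U * F) $ n = 0"
    by (metis fps_shift_nth fps_zero_nth le_add_diff_inverse2)
  thus ?thesis by (intro exI[of _ "Q * U"] exI[of _ "f - Q * U * F"]) (simp add: d_def)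
qed

text \<open>Divide \<open>z^d\<close> by \<open>F\<close>. The remainder vanishes in the residue
  field, so the reduced quotient has order 0 and the quotient is a unit.\<close>

lemma weierstrass_preparation:
  assumes F: "R F \<noteq> 0"
  defines "d \<equiv> subdegree (R F)"
  obtains u P where "u dvd 1" "F = u * P" "R P = fps_X ^ d"
    "\<And>n. n > d \<Longrightarrow> P $ n = 0" "P $ d = 1"
proof -
  obtain q r where q: "fps_X ^ d = q * F + r" and r: "\<And>n. n \<ge> d \<Longrightarrow> r $ n = 0"
    using weierstrass_division[OF F, of "fps_X ^ d"] by (auto simp: d_def)
  define P where "P = fps_X ^ d - r"
  have P: "P = q * F" by (simp add: P_def q)
  have "R r = 0"
  proof (rule fps_ext)
    fix k
    have "R (q * F) $ k = 0" if "k < d"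
      using that F by (cases "R q = 0")
        (auto simp: R_mult d_def intro!: nth_less_subdegree_zero)
    moreover have "R r $ k = R (fps_X ^ d) $ k - R (q * F) $ k"
      by (simp add: q R_add)
    ultimately show "R r $ k = 0 $ k"
      using r by (cases "k < d") (auto simp: R_power R_X R_nth red_zero)
  qed
  hence RP: "R P = fps_X ^ d" by (simp add: P_def R_diff R_power R_X)
  hence qF: "R q * R F = fps_X ^ d" by (simp add: P R_mult)
  hence "R q \<noteq> 0" by (metis fps_X_power_iff mult_zero_left power_not_zero fps_X_neq_zero)
  moreover have "subdegree (R q) + subdegree (R F) = d"
    using \<open>R q \<noteq> 0\<close> F subdegree_mult[of "R q" "R F"] by (simp add: qF)
  ultimately have "R q $ 0 \<noteq> 0" using nth_subdegree_nonzero[of "R q"] by (simp add: d_def)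
  hence "q dvd 1" by (metis fps_unit_iff R_nth)
  then obtain u where u: "q * u = 1" by (metis dvdE)
  show ?thesis
  proof
    show "u dvd 1" using dvd_triv_right[of u q] u by simp
    have "u * P = (q * u) * F" by (simp only: P mult_ac)
    thus "F = u * P" by (simp add: u)
  qed (use r RP in \<open>auto simp: P_def\<close>)
qed

text \<open>Write \<open>f = q F + r\<close> with \<open>F = g z - z\<close> and \<open>r\<close> a
  polynomial. The polynomial case handles \<open>r\<close>; it also shows that \<open>g\<close>
  preserves the ideal of \<open>F\<close>, because \<open>F\<close> is a unit times a
  polynomial.\<close>

lemma disp_dvd:
  assumes "fps_endo g" and F: "R (g fps_X - fps_X) \<noteq> 0"
  shows "(g fps_X - fps_X) dvd (g f - f)"
proof -
  interpret fps_endo g by fact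
  define F where "F = g fps_X - fps_X"
  obtain u P where u: "u dvd 1" and FP: "F = u * P"
    and deg: "\<And>n. n > subdegree (R F) \<Longrightarrow> P $ n = 0"
    using weierstrass_preparation[OF F] unfolding F_def by metis
  have "P dvd F" by (simp add: FP)
  obtain w where w: "u * w = 1" using u by (metis dvdE)
  have "w * F = (u * w) * P" by (simp only: FP mult_ac)
  hence "F dvd P" using dvd_triv_right[of F w] by (simp add: w)
  moreover have "F dvd g P - P"
    unfolding F_def by (rule disp_dvd_poly[of "Suc (subdegree (R F))"]) (simp add: deg)
  ultimately have "F dvd g P" using dvd_add[of F "g P - P" P] by simp
  hence gF: "F dvd g F" by (simp add: FP hom_mult)
  obtain q r where "f = q * F + r" and r: "\<And>n. n \<ge> subdegree (R F) \<Longrightarrow> r $ n = 0"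
    using weierstrass_division[OF F, of f] by (auto simp: F_def)
  hence "g f - f = g q * g F - q * F + (g r - r)" by (simp add: homs)
  moreover have "F dvd g r - r"
    unfolding F_def by (rule disp_dvd_poly) (rule r)
  ultimately show ?thesis
    using gF by (fold F_def) simp
qed

end

section \<open>The fixed points of \<open>s\<close>\<close>

text \<open>The zeros of \<open>P\<close> may lie outside \<open>R\<close>, so evaluation at them is
  replaced by congruence modulo \<open>P\<close>; \<open>division\<close> and
  \<open>remainder_unique\<close> make the residue ring free with basis 1, \<open>z\<close>.\<close>

locale two_fixed_points = complete_residue_hom red p + s: fps_endo s
  for red :: "'r::idom \<Rightarrow> 'k::field" and p and s :: "'r fps \<Rightarrow> 'r fps" +
  fixes u P :: "'r fps" and a b :: 'r
  assumes disp: "s fps_X - fps_X = u * P"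
    and u_unit: "u dvd 1"
    and P_eq: "P = fps_X ^ 2 - fps_const a * fps_X + fps_const b"
    and red_a: "red a = 0" and red_b: "red b = 0"
begin

lemma R_P: "R P = fps_X ^ 2"
proof -
  have "R (fps_const c) = 0" if "red c = 0" for c
    using that by (simp add: fps_eq_iff R_nth red_zero)
  thus ?thesis by (simp add: P_eq R_add R_diff R_mult R_power R_X red_a red_b)
qed

lemma P_nonzero: "P \<noteq> 0"
  using R_P R_zero by force

lemma P_not_unit: "\<not> P dvd 1"
  by (simp add: fps_unit_iff P_eq red_b)

lemma R_disp: "R (s fps_X - fps_X) \<noteq> 0"
proof -
  have "R u \<noteq> 0" using R_dvd[OF u_unit] by (auto simp: R_one)
  thus ?thesis by (simp add: disp R_mult R_P)
qed

lemma division: "\<exists>c d. eqmod P f (fps_const c + fps_const d * fps_X)"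
proof -
  have "R P \<noteq> 0" by (simp add: R_P)
  from weierstrass_division[OF this, of f] obtain q r
    where "f = q * P + r" and r: "\<And>n. n \<ge> 2 \<Longrightarrow> r $ n = 0"
    by (auto simp: R_P)
  hence "eqmod P f r" by (simp add: eqmod_def)
  moreover have "r = fps_const (r $ 0) + fps_const (r $ 1) * fps_X"
  proof (rule fps_ext)
    fix n :: nat
    consider "n = 0" | "n = 1" | "n \<ge> 2" by linarith
    thus "r $ n = (fps_const (r $ 0) + fps_const (r $ 1) * fps_X) $ n"
      by cases (auto simp: r fps_X_def)
  qed
  ultimately show ?thesis by metis
qed

lemma remainder_unique:
  assumes "P dvd fps_const c + fps_const d * fps_X"
  shows "c = 0" "d = 0"
proof -
  obtain q where q: "fps_const c + fps_const d * fps_X = P * q"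
    using assms by (rule dvdE)
  \<comment> \<open>Coefficients of degree at least 2 in \<open>P * q\<close> vanish. As
    \<open>p\<close> divides \<open>a\<close> and \<open>b\<close>, iterating the recurrence makes
    \<open>q\<close> divisible by every power of \<open>p\<close>.\<close>
  have rec: "q $ n = a * q $ Suc n - b * q $ Suc (Suc n)" for n
  proof -
    have "(P * q) $ Suc (Suc n) = q $ n - a * q $ Suc n + b * q $ Suc (Suc n)"
      by (simp add: P_eq algebra_simps power2_eq_square)
    moreover have "(P * q) $ Suc (Suc n) = 0"
      by (simp flip: q add: fps_X_def)
    ultimately show ?thesis by (simp add: algebra_simps)
  qed
  have "p ^ m dvd q $ n" for m n
  proof (induction m arbitrary: n)
    case (Suc m)
    show ?case
      unfolding rec[of n] power_Suc using red_a red_b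
      by (intro dvd_diff mult_dvd_mono Suc) (simp_all add: red_eq_0_iff)
  qed simp
  hence "q = 0" by (intro fps_separated) (simp add: fps_const_dvd_iff)
  hence "fps_const c + fps_const d * fps_X = 0" by (simp add: q)
  from arg_cong[OF this, of "\<lambda>f. f $ 0"] arg_cong[OF this, of "\<lambda>f. f $ 1"]
  show "c = 0" "d = 0" by simp_all
qed

text \<open>A free module over a domain is torsion-free; concretely, the linear remainder of
  \<open>f\<close> is multiplied by \<open>c\<close>.\<close>

lemma const_mult_dvd_cancel:
  assumes "c \<noteq> 0" "P dvd fps_const c * f"
  shows "P dvd f"
proof -
  obtain d e where de: "eqmod P f (fps_const d + fps_const e * fps_X)"
    using division by blast
  have "eqmod P (fps_const c * f) (fps_const c * (fps_const d + fps_const e * fps_X))"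
    by (intro eqmod_mult eqmod_refl de)
  hence "P dvd fps_const c * (fps_const d + fps_const e * fps_X)"
    using assms(2) by (metis eqmod_0_iff eqmod_sym eqmod_trans)
  hence "P dvd fps_const (c * d) + fps_const (c * e) * fps_X"
    by (simp add: algebra_simps flip: fps_const_mult)
  from remainder_unique[OF this] have "d = 0" "e = 0" using assms(1) by auto
  thus ?thesis using de by (simp add: eqmod_0_iff)
qed

lemma two_mult_dvd_cancel: "P dvd 2 * f \<Longrightarrow> P dvd f"
  using const_mult_dvd_cancel[OF two_nonzero, of f] by (simp only: numeral_fps_const)

lemma s_triv: "eqmod P (s f) f"
  using dvd_trans[OF _ disp_dvd[OF s.fps_endo_axioms R_disp, of f]]
  by (simp add: eqmod_def disp)

end

section \<open>The action of a quaternion pair on the zeros of \<open>P\<close>\<close>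

locale quaternion_fps = two_fixed_points red p s u P a b + quaternion_endos s r + r: fps_endo r
  for red :: "'r::idom \<Rightarrow> 'k::field" and p s u P a b r +
  assumes R_ss: "R (s (s fps_X) - fps_X) \<noteq> 0"
    and R_r: "R (r fps_X - fps_X) \<noteq> 0"
begin

lemma ss_triv: "eqmod P (s (s f)) f"
  using eqmod_trans s_triv by blast

text \<open>Reduction turns \<open>P ^ N\<close> into \<open>z^(2 N)\<close>, whose order exceeds
  that of the nonzero reduction of \<open>s^2 z - z\<close> for large \<open>N\<close>.\<close>

lemma ss_disp_not_dvd: "\<exists>N. \<not> P ^ N dvd s (s fps_X) - fps_X"
proof
  define N where "N = Suc (subdegree (R (s (s fps_X) - fps_X)))"
  show "\<not> P ^ N dvd s (s fps_X) - fps_X"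
  proof
    assume "P ^ N dvd s (s fps_X) - fps_X"
    from R_dvd[OF this] have "fps_X ^ (2 * N) dvd R (s (s fps_X) - fps_X)"
      by (simp add: R_power R_P power_mult)
    from dvd_imp_subdegree_le[OF this R_ss] show False by (simp add: N_def)
  qed
qed

text \<open>Since \<open>r\<close> conjugates \<open>s\<close> to its inverse, it preserves the
  fixed locus: \<open>r (s z - z)\<close> is \<open>s^3 - 1\<close> applied to \<open>r z\<close>,
  hence a multiple of \<open>P\<close>, and it equals \<open>r P\<close> up to a unit.\<close>

lemma r_dvd: "P dvd f \<Longrightarrow> P dvd r f"
proof -
  have "r (s fps_X) - r fps_X = s (s (s (r fps_X))) - r fps_X" by (simp add: rs)
  moreover have "eqmod P (s (s (s (r fps_X)))) (r fps_X)"
    using eqmod_trans s_triv by blast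
  ultimately have "P dvd r (s fps_X - fps_X)" by (simp add: r.hom_diff eqmod_def)
  hence "P dvd r u * r P" by (simp add: disp r.hom_mult)
  hence "eqmod P (r u * r P) (r u * 0)" by (simp add: eqmod_0_iff)
  moreover have "r u dvd 1" using r.hom_dvd[OF u_unit] by (simp add: r.hom_one)
  ultimately have "P dvd r P" using eqmod_unit_cancel eqmod_0_iff by blast
  thus "P dvd f \<Longrightarrow> P dvd r f" using r.hom_dvd dvd_trans by blast
qed

lemma r_eqmod: "eqmod P f g \<Longrightarrow> eqmod P (r f) (r g)"
  unfolding eqmod_def using r_dvd by (simp flip: r.hom_diff)

text \<open>Otherwise \<open>r\<close> would fix all linear remainders, so \<open>s\<close> and
  \<open>r\<close> would have the common fixed locus excluded by
  \<open>no_common_fixed_locus\<close>.\<close>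

lemma r_not_triv: "\<not> eqmod P (r fps_X) fps_X"
proof
  assume X: "eqmod P (r fps_X) fps_X"
  have "eqmod P (r f) f" for f
  proof -
    obtain c d where f: "eqmod P f (fps_const c + fps_const d * fps_X)"
      using division by blast
    have "eqmod P (r f) (r (fps_const c + fps_const d * fps_X))"
      by (rule r_eqmod[OF f])
    also have "r (fps_const c + fps_const d * fps_X) = fps_const c + fps_const d * r fps_X"
      by (simp add: r.homs r.hom_const)
    also have "eqmod P \<dots> (fps_const c + fps_const d * fps_X)"
      by (intro eqmod_add eqmod_mult eqmod_refl X)
    also have "eqmod P \<dots> f" by (rule eqmod_sym[OF f])
    finally show ?thesis .
  qed
  moreover obtain N where "\<not> P ^ N dvd s (s fps_X) - fps_X"
    using ss_disp_not_dvd by blast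
  ultimately show False
    using no_common_fixed_locus[OF P_nonzero s_triv _ two_mult_dvd_cancel ss_neg] by blast
qed

text \<open>The two zeros of \<open>P\<close> are the fixed points of \<open>s\<close>. Since \<open>r\<close> inverts \<open>s\<close>
  under conjugation and fixes neither of them, it exchanges them.\<close>

lemma r_X: "eqmod P (r fps_X) (fps_const a - fps_X)"
proof -
  obtain c d where cd: "eqmod P (r fps_X) (fps_const c + fps_const d * fps_X)"
    using division by blast
  have "eqmod P (r (r fps_X)) (r (fps_const c + fps_const d * fps_X))"
    by (rule r_eqmod[OF cd])
  also have "r (fps_const c + fps_const d * fps_X) = fps_const c + fps_const d * r fps_X"
    by (simp add: r.homs r.hom_const)
  also have "eqmod P \<dots> (fps_const c + fps_const d * (fps_const c + fps_const d * fps_X))"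
    by (intro eqmod_add eqmod_mult eqmod_refl cd)
  finally have "eqmod P fps_X (fps_const c + fps_const d * (fps_const c + fps_const d * fps_X))"
    using ss_triv[of fps_X] unfolding rr by (metis eqmod_sym eqmod_trans)
  from eqmod_sym[OF this] have "P dvd fps_const (c + d * c) + fps_const (d * d - 1) * fps_X"
    by (simp add: eqmod_def algebra_simps flip: fps_const_mult fps_const_add fps_const_sub)
  from remainder_unique[OF this] have c: "c * (1 + d) = 0" and d: "d * d = 1"
    by (simp_all add: algebra_simps)
  have "d = - 1"
  proof (rule ccontr)
    assume "d \<noteq> - 1"
    hence "d = 1" "c = 0" using d c square_eq_1_iff[of d] by (auto simp: add_eq_0_iff)
    with cd r_not_triv show False by simp
  qed
  hence cX: "eqmod P (r fps_X) (fps_const c - fps_X)"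
    using cd by (simp flip: fps_const_neg)
  \<comment> \<open>The involution \<open>c - z\<close> must preserve the zeros of \<open>P\<close>;
    the coefficient of \<open>z\<close> then determines \<open>c\<close>.\<close>
  have "eqmod P (r P) ((fps_const c - fps_X) ^ 2 - fps_const a * (fps_const c - fps_X) + fps_const b)"
    unfolding P_eq r.homs r.hom_const power2_eq_square
    unfolding P_eq[symmetric, unfolded power2_eq_square]
    by (intro eqmod_add eqmod_diff eqmod_mult eqmod_refl cX)
  moreover have "eqmod P (r P) P"
    using r_dvd[of P] by (simp add: eqmod_def)
  ultimately have "eqmod P
      ((fps_const c - fps_X) ^ 2 - fps_const a * (fps_const c - fps_X) + fps_const b) P"
    by (metis eqmod_sym eqmod_trans)
  moreover have "(fps_const c - fps_X) ^ 2 - fps_const a * (fps_const c - fps_X) + fps_const b - P =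
      fps_const (c * c - a * c) + fps_const (a - c + (a - c)) * fps_X"
    by (simp add: P_eq power2_eq_square algebra_simps
          flip: fps_const_mult fps_const_add fps_const_sub)
  ultimately have "P dvd fps_const (c * c - a * c) + fps_const (a - c + (a - c)) * fps_X"
    by (metis eqmod_def)
  from remainder_unique(2)[OF this] have "2 * (a - c) = 0" by simp
  hence "c = a" using two_nonzero by simp
  with cX show ?thesis by simp
qed

lemma r_disp: "eqmod P (r fps_X - fps_X) (fps_const a - 2 * fps_X)"
  using eqmod_diff[OF r_X eqmod_refl[of P fps_X]] by (simp add: algebra_simps)

end

section \<open>The multiplier of \<open>s\<close> and the factorization of
  \<open>s^2 z - z\<close>\<close>

context quaternion_fps
begin

text \<open>Expanding \<open>P\<close> at \<open>z + u P\<close> produces this factor. Modulo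
  \<open>P\<close> it is \<open>1 + u P'\<close>, the derivative of \<open>s\<close> at the zeros of
  \<open>P\<close>.\<close>

definition \<theta> where "\<theta> = 1 + u * (2 * fps_X - fps_const a) + u ^ 2 * P"

lemma s_P: "s P = \<theta> * P"
proof -
  have "s fps_X = fps_X + u * P" using disp by (simp add: algebra_simps)
  hence "s P = (fps_X + u * P) ^ 2 - fps_const a * (fps_X + u * P) + fps_const b"
    by (subst P_eq) (simp only: s.homs s.hom_const)
  also have "\<dots> = fps_X ^ 2 - fps_const a * fps_X + fps_const b
      + (u * (2 * fps_X - fps_const a) + u ^ 2 * P) * P"
    by (simp add: algebra_simps power2_eq_square)
  finally show ?thesis by (simp only: P_eq[symmetric]) (simp add: \<theta>_def algebra_simps)
qed

lemma \<theta>_unit: "\<theta> dvd 1"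
  using semi_invariant_unit[of P s \<theta>] P_nonzero s_P by simp

lemma \<theta>_eqmod: "eqmod P (1 - \<theta>) (u * (fps_const a - 2 * fps_X))"
proof -
  have "1 - \<theta> - u * (fps_const a - 2 * fps_X) = P * (- (u ^ 2))"
    by (simp add: \<theta>_def algebra_simps)
  thus ?thesis unfolding eqmod_def by (metis dvd_triv_left)
qed

text \<open>The square of \<open>s\<close> commutes with \<open>r\<close>, so its multiplier on \<open>(P) / (P\<^sup>2)\<close> is
  invariant under \<open>z \<mapsto> a - z\<close> and hence a constant. Its square is \<open>1\<close>, and it is not \<open>1\<close>.\<close>

lemma ss_P: "eqmod P (s \<theta> * \<theta>) (- 1)"
proof -
  define \<chi> where "\<chi> = s \<theta> * \<theta>"
  have \<chi>: "s (s P) = \<chi> * P" by (simp add: \<chi>_def s_P s.homs mult_ac)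
  obtain v where v: "r P = v * P"
    using r_dvd[of P] by (metis dvd_refl dvdE mult.commute)
  \<comment> \<open>Applying \<open>ss_r\<close> to \<open>P\<close> compares the two multipliers;
    modulo \<open>P\<close> the unit \<open>v\<close> cancels and \<open>\<chi>\<close> is invariant
    under \<open>r\<close>.\<close>
  have "r \<chi> * v * P = s (s v) * \<chi> * P"
    using ss_r[of P] by (simp add: v \<chi> s.homs r.homs mult_ac)
  hence eq: "s (s v) * \<chi> = r \<chi> * v" using P_nonzero mult_right_cancel by metis
  have "eqmod P (v * \<chi>) (s (s v) * \<chi>)"
    by (intro eqmod_mult eqmod_refl eqmod_sym[OF ss_triv])
  hence "eqmod P (v * \<chi>) (v * r \<chi>)" by (simp only: eq mult.commute[of "r \<chi>" v])
  moreover have "v dvd 1"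
    using semi_invariant_unit[of P r v] P_nonzero v by simp
  ultimately have r\<chi>: "eqmod P \<chi> (r \<chi>)" using eqmod_unit_cancel by blast
  obtain c d where cd: "eqmod P \<chi> (fps_const c + fps_const d * fps_X)"
    using division by blast
  have "eqmod P (r \<chi>) (r (fps_const c + fps_const d * fps_X))"
    by (rule r_eqmod[OF cd])
  also have "r (fps_const c + fps_const d * fps_X) = fps_const c + fps_const d * r fps_X"
    by (simp add: r.homs r.hom_const)
  also have "eqmod P \<dots> (fps_const c + fps_const d * (fps_const a - fps_X))"
    by (intro eqmod_add eqmod_mult eqmod_refl r_X)
  finally have "eqmod P (fps_const c + fps_const d * (fps_const a - fps_X))
      (fps_const c + fps_const d * fps_X)"
    using r\<chi> cd by (metis eqmod_sym eqmod_trans)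
  moreover have "fps_const c + fps_const d * (fps_const a - fps_X) -
      (fps_const c + fps_const d * fps_X) = fps_const (d * a) + fps_const (- (d + d)) * fps_X"
    by (simp add: algebra_simps flip: fps_const_mult fps_const_add fps_const_neg)
  ultimately have "P dvd fps_const (d * a) + fps_const (- (d + d)) * fps_X"
    by (metis eqmod_def)
  from remainder_unique(2)[OF this] have "2 * d = 0" by (simp add: algebra_simps)
  hence \<chi>c: "eqmod P \<chi> (fps_const c)" using cd two_nonzero by simp
  have "s (s \<chi>) * \<chi> * P = 1 * P"
    using ssss[of P] by (simp add: \<chi> s.homs mult_ac)
  hence "s (s \<chi>) * \<chi> = 1" using P_nonzero mult_right_cancel by blast
  moreover have "eqmod P (\<chi> * \<chi>) (s (s \<chi>) * \<chi>)"
    by (intro eqmod_mult eqmod_refl eqmod_sym[OF ss_triv])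
  moreover have "eqmod P (\<chi> * \<chi>) (fps_const c * fps_const c)"
    by (intro eqmod_mult \<chi>c)
  ultimately have "eqmod P (fps_const c * fps_const c) 1"
    by (metis eqmod_sym eqmod_trans)
  hence "P dvd fps_const (c * c - 1) + fps_const 0 * fps_X"
    by (simp add: eqmod_def flip: fps_const_mult fps_const_sub)
  from remainder_unique(1)[OF this] have "c * c = 1" by simp
  moreover have "c \<noteq> 1"
  proof
    assume "c = 1"
    hence "eqmod P \<chi> 1" using \<chi>c by simp
    moreover obtain N where "\<not> P ^ N dvd s (s fps_X) - fps_X"
      using ss_disp_not_dvd by blast
    ultimately show False
      using ss_not_unipotent[OF s_triv two_mult_dvd_cancel ss_neg _ \<chi>] by blast
  qed
  ultimately have "c = - 1" using square_eq_1_iff by blast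
  thus ?thesis using \<chi>c by (simp add: \<chi>_def flip: fps_const_neg)
qed

lemma \<theta>_square: "eqmod P (\<theta> * \<theta>) (- 1)"
  using eqmod_trans[OF eqmod_mult[OF eqmod_sym[OF s_triv] eqmod_refl] ss_P] .

text \<open>The quotient is congruent to \<open>u (1 + \<theta>)\<close>. Replacing 1 by
  \<open>- \<theta>^2\<close> turns this into \<open>u \<theta> (1 - \<theta>)\<close>, and
  \<open>1 - \<theta>\<close> is congruent to \<open>u (r z - z)\<close>.\<close>

lemma ss_disp:
  obtains E where "s (s fps_X) - fps_X = P * E"
    "eqmod P E (\<theta> * u ^ 2 * (r fps_X - fps_X))"
proof
  have sX: "s fps_X = fps_X + u * P" using disp by (simp add: algebra_simps)
  show "s (s fps_X) - fps_X = P * (s u * \<theta> + u)"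
    by (simp add: sX s.homs s_P algebra_simps)
  have "eqmod P (s u * \<theta> + u * 1) (u * \<theta> + u * (- (\<theta> * \<theta>)))"
    by (intro eqmod_add eqmod_mult eqmod_refl s_triv)
      (use eqmod_diff[OF eqmod_refl[of P 0] \<theta>_square] in \<open>simp add: eqmod_sym\<close>)
  also have "u * \<theta> + u * (- (\<theta> * \<theta>)) = u * \<theta> * (1 - \<theta>)"
    by (simp add: algebra_simps)
  also have "eqmod P \<dots> (u * \<theta> * (u * (r fps_X - fps_X)))"
    by (intro eqmod_mult eqmod_refl eqmod_trans[OF \<theta>_eqmod] eqmod_sym[OF r_disp])
  also have "u * \<theta> * (u * (r fps_X - fps_X)) = \<theta> * u ^ 2 * (r fps_X - fps_X)"
    by (simp add: power2_eq_square mult_ac)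
  finally show "eqmod P (s u * \<theta> + u) (\<theta> * u ^ 2 * (r fps_X - fps_X))" by simp
qed

text \<open>The two zeros of \<open>P\<close> are distinct: the square of \<open>a - 2 z\<close> is
  congruent to the discriminant \<open>D\<close> of \<open>P\<close>, a nonzero constant, and
  constants can be cancelled.\<close>

lemma r_disp_cancel:
  assumes "P dvd (r fps_X - fps_X) * f"
  shows "P dvd f"
proof -
  define w where "w = fps_const a - 2 * fps_X"
  define D where "D = a * a - (b + b + (b + b))"
  have w2: "w * w = P * 4 + fps_const D"
    by (simp add: w_def D_def P_eq power2_eq_square algebra_simps
        flip: fps_const_mult fps_const_add fps_const_sub)
  hence wD: "eqmod P (w * w) (fps_const D)" by (simp add: eqmod_def)
  \<comment> \<open>If \<open>D = 0\<close>, then \<open>(1 - \<theta>)^2\<close> is congruent to 0;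
    by \<open>\<theta>_square\<close> it is also congruent to \<open>- 2 \<theta>\<close>, although
    \<open>\<theta>\<close> is a unit.\<close>
  have "D \<noteq> 0"
  proof
    assume "D = 0"
    hence "eqmod P (w * w) 0" using wD by simp
    hence "eqmod P (u * u * (w * w)) (u * u * 0)" by (intro eqmod_mult eqmod_refl)
    moreover have "eqmod P ((1 - \<theta>) * (1 - \<theta>)) (u * w * (u * w))"
      unfolding w_def by (intro eqmod_mult \<theta>_eqmod)
    ultimately have "eqmod P ((1 - \<theta>) * (1 - \<theta>)) 0"
      by (metis eqmod_trans mult.assoc mult.left_commute mult_zero_right)
    from eqmod_diff[OF \<theta>_square this] have "P dvd - 1 - (\<theta> * \<theta> - (1 - \<theta>) * (1 - \<theta>))"
      unfolding eqmod_def by (metis diff_zero dvd_minus_iff minus_diff_eq)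
    hence "P dvd 2 * (- \<theta>)" by (simp add: algebra_simps)
    from two_mult_dvd_cancel[OF this] have "P dvd \<theta>" by simp
    thus False using \<theta>_unit P_not_unit dvd_trans by blast
  qed
  have "eqmod P ((r fps_X - fps_X) * f) (w * f)"
    unfolding w_def by (intro eqmod_mult eqmod_refl r_disp)
  hence "eqmod P (w * f) 0"
    using assms by (metis eqmod_0_iff eqmod_sym eqmod_trans)
  hence w0: "eqmod P (w * (w * f)) (w * 0)" by (intro eqmod_mult eqmod_refl)
  have "eqmod P (fps_const D * f) (w * w * f)"
    by (intro eqmod_mult eqmod_refl eqmod_sym[OF wD])
  also have "w * w * f = w * (w * f)" by (rule mult.assoc)
  also note w0
  finally have "P dvd fps_const D * f" by (simp only: mult_zero_right eqmod_0_iff)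
  thus ?thesis by (rule const_mult_dvd_cancel[OF \<open>D \<noteq> 0\<close>])
qed

lemma unit_mult: "v dvd 1 \<Longrightarrow> w dvd 1 \<Longrightarrow> v * w dvd (1 :: 'r fps)"
  using mult_dvd_mono[of v 1 w 1] by simp

text \<open>This sharpens the congruence of \<open>ss_disp\<close> to an equality. By
  \<open>disp_dvd\<close>, \<open>F = r z - z\<close> divides \<open>r^2 z - z = s^2 z - z\<close>;
  since \<open>F\<close> can be cancelled modulo \<open>P\<close>, the product \<open>P F\<close>
  divides it as well.\<close>

lemma ss_disp_factor:
  obtains g where "g dvd 1" "s (s fps_X) - fps_X = P * ((r fps_X - fps_X) * g)"
proof -
  define F where "F = r fps_X - fps_X"
  obtain E where E: "s (s fps_X) - fps_X = P * E" "eqmod P E (\<theta> * u ^ 2 * F)"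
    using ss_disp unfolding F_def by blast
  have "F dvd r F - F"
    unfolding F_def by (rule disp_dvd[OF r.fps_endo_axioms R_r])
  hence "F dvd (r F - F) + F + F" by (intro dvd_add) simp_all
  moreover have "s (s fps_X) - fps_X = (r F - F) + F + F"
    by (simp add: F_def r.homs flip: rr)
  ultimately obtain k where k: "s (s fps_X) - fps_X = F * k" by (metis dvdE)
  have "P dvd s (s fps_X) - fps_X" by (simp add: E(1))
  hence "P dvd F * k" by (simp only: k)
  hence "P dvd k" by (rule r_disp_cancel[folded F_def])
  then obtain g where g: "k = P * g" by (rule dvdE)
  have "P * E = F * (P * g)" by (simp only: E(1)[symmetric] k g)
  hence "P * E = P * (F * g)" by (simp only: mult.left_commute)
  hence Eg: "E = F * g" using P_nonzero mult_left_cancel by blast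
  have "P dvd F * (g - \<theta> * u ^ 2)"
    using E(2) by (simp add: Eg eqmod_def algebra_simps)
  hence "P dvd g - \<theta> * u ^ 2" by (rule r_disp_cancel[folded F_def])
  \<comment> \<open>\<open>P\<close> reduces to \<open>z^2\<close>, so \<open>g\<close> and the unit
    \<open>\<theta> * u ^ 2\<close> have equal constant terms in the residue field.\<close>
  from R_dvd[OF this] obtain h where "R g - R (\<theta> * u ^ 2) = fps_X ^ 2 * h"
    by (auto simp: R_diff R_P elim: dvdE)
  from arg_cong[OF this, of "\<lambda>f. f $ 0"] have "red (g $ 0) = red ((\<theta> * u ^ 2) $ 0)"
    by (simp add: R_nth)
  moreover have "\<theta> * u ^ 2 dvd 1"
    by (simp add: power2_eq_square unit_mult \<theta>_unit u_unit)
  ultimately have "g dvd 1" by (simp only: fps_unit_iff not_False_eq_True)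
  moreover have "s (s fps_X) - fps_X = P * (F * g)" by (simp add: E(1) Eg)
  ultimately show thesis using that by (simp add: F_def)
qed

text \<open>Both \<open>r\<close> and \<open>r \<circ> s\<close> have the same fixed locus, namely that of \<open>s\<^sup>2\<close> with the zeros of
  \<open>P\<close> removed; so \<open>s\<close> also fixes it, although \<open>r\<close> moves the zeros of \<open>P\<close>.\<close>

lemma no_lift:
  assumes R_rs: "R (r (s fps_X) - fps_X) \<noteq> 0"
  shows False
proof -
  have "quaternion_fps red p s u P a b (\<lambda>f. r (s f))"
    by (intro quaternion_fps.intro two_fixed_points_axioms rotate quaternion_fps_axioms.intro
        R_ss R_rs) (unfold_locales, simp_all add: s.homs r.homs s.hom_const r.hom_const)
  then interpret rs: quaternion_fps red p s u P a b "\<lambda>f. r (s f)" .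
  define F where "F = r fps_X - fps_X"
  obtain g where g: "g dvd 1" "s (s fps_X) - fps_X = P * (F * g)"
    using ss_disp_factor unfolding F_def by blast
  obtain h where h: "h dvd 1"
    "s (s fps_X) - fps_X = P * ((r (s fps_X) - fps_X) * h)"
    using rs.ss_disp_factor by blast
  have "P * (F * g) = P * ((r (s fps_X) - fps_X) * h)" by (simp only: g(2)[symmetric] h(2))
  hence "F * g = (r (s fps_X) - fps_X) * h" using P_nonzero mult_left_cancel by blast
  also have "r (s fps_X) - fps_X = F + r (u * P)"
    by (simp add: F_def r.hom_diff flip: disp)
  \<comment> \<open>After cancelling the units \<open>h\<close>, \<open>r u\<close> and
    \<open>v\<close>, this says that \<open>F\<close> divides \<open>P\<close>.\<close>
  finally have "h * r (u * P) = F * (g - h)" by (simp add: algebra_simps)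
  hence "eqmod F (h * r u * r P) (h * r u * 0)"
    by (simp add: eqmod_0_iff r.hom_mult mult.assoc)
  moreover have "h * r u dvd 1"
    using r.hom_dvd[OF u_unit] h(1) by (intro unit_mult) (simp_all add: r.hom_one)
  ultimately have "eqmod F (r P) 0" by (rule eqmod_unit_cancel[rotated])
  moreover obtain v where v: "r P = v * P"
    using r_dvd[of P] by (metis dvd_refl dvdE mult.commute)
  ultimately have "eqmod F (v * P) (v * 0)" by simp
  moreover have "v dvd 1" using semi_invariant_unit[of P r v] P_nonzero v by simp
  ultimately have "F dvd P" using eqmod_unit_cancel eqmod_0_iff by blast
  then obtain q where q: "P = F * q" by (rule dvdE)
  hence "P dvd F * q" by simp
  hence "P dvd q" by (rule r_disp_cancel[folded F_def])
  then obtain q' where "q = P * q'" by (rule dvdE)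
  hence "P * 1 = P * (F * q')" using q by (simp add: mult_ac)
  hence "1 = F * q'" using P_nonzero mult_left_cancel by blast
  hence "F dvd 1" by (rule dvdI)
  \<comment> \<open>\<open>F\<close> is \<open>a - 2 z\<close> plus a multiple of \<open>P\<close>,
    so its constant term lies in the maximal ideal.\<close>
  moreover obtain x where "F - (fps_const a - 2 * fps_X) = P * x"
    using r_disp unfolding F_def eqmod_def by (rule dvdE)
  hence "F = fps_const a - 2 * fps_X + P * x" by (simp add: algebra_simps)
  hence "red (F $ 0) = 0"
    by (simp add: red_add red_mult red_a P_eq red_b)
  ultimately show False by (simp add: fps_unit_iff)
qed

end

section \<open>Discrete valuation rings and completeness\<close>

lemma ring_of_type_algebra_simps [simp]:
  "carrier (ring_of_type_algebra :: 'a::ring_1 ring) = UNIV"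
  "monoid.mult (ring_of_type_algebra :: 'a ring) = (*)"
  "monoid.one (ring_of_type_algebra :: 'a ring) = 1"
  "ring.zero (ring_of_type_algebra :: 'a ring) = 0"
  "ring.add (ring_of_type_algebra :: 'a ring) = (+)"
  by (simp_all add: ring_of_type_algebra_def)

lemma ideal_ring_of_type_algebraI:
  fixes I :: "'a::comm_ring_1 set"
  assumes "0 \<in> I" "\<And>a b. a \<in> I \<Longrightarrow> b \<in> I \<Longrightarrow> a + b \<in> I" "\<And>a x. a \<in> I \<Longrightarrow> x * a \<in> I"
  shows "ideal I ring_of_type_algebra"
proof -
  interpret A: cring "ring_of_type_algebra :: 'a ring" by (rule cring_from_type_algebra)
  have minus: "\<ominus>\<^bsub>ring_of_type_algebra\<^esub> a = - a" for a :: 'a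
    by (rule A.minus_equality) simp_all
  show ?thesis
  proof (rule idealI)
    show "subgroup I (add_monoid ring_of_type_algebra)"
      using assms(1,2) assms(3)[of _ "- 1"] minus unfolding a_inv_def
      by unfold_locales auto
  qed (use assms(3) A.ring_axioms in \<open>auto simp: mult.commute\<close>)
qed

lemma cgenideal_ring_of_type_algebra:
  "PIdl\<^bsub>ring_of_type_algebra\<^esub> (a :: 'a::comm_ring_1) = {x. a dvd x}"
  by (auto simp: cgenideal_def dvd_def mult.commute)

lemma Units_ring_of_type_algebra:
  "Units (ring_of_type_algebra :: 'a::comm_ring_1 ring) = {a. a dvd 1}"
proof -
  have "a dvd 1 \<longleftrightarrow> (\<exists>b. b * a = 1 \<and> a * b = 1)" for a :: 'a
    by (metis dvd_def mult.commute)
  thus ?thesis by (simp add: Units_def)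
qed

lemma discrete_valuation_ring_residue_hom:
  fixes red :: "'r::idom \<Rightarrow> 'k::field"
  assumes dvr: "discrete_valuation_ring (ring_of_type_algebra :: 'r ring)"
    and red: "red \<in> ring_hom ring_of_type_algebra ring_of_type_algebra"
    and char: "CHAR('r) = 0" "CHAR('k) \<noteq> 0"
  obtains p where "residue_hom red p"
    "\<And>x. x \<noteq> 0 \<Longrightarrow> \<exists>n. x dvd p ^ n"
proof -
  define A where "A = (ring_of_type_algebra :: 'r ring)"
  interpret A: principal_domain A
    using dvr by (simp add: discrete_valuation_ring_def A_def)
  have unique: "P = Q" if "primeideal P A" "P \<noteq> {0}" "primeideal Q A" "Q \<noteq> {0}" for P Q
    using dvr that by (auto simp: discrete_valuation_ring_def A_def)
  have add: "red (a + b) = red a + red b" and mult: "red (a * b) = red a * red b"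
    and one: "red 1 = 1" for a b
    using ring_hom_add[OF red] ring_hom_mult[OF red] ring_hom_one[OF red] by auto
  have zero: "red 0 = 0" using add[of 0 0] by (metis add_0_right add_cancel_right_right)
  define K where "K = {x. red x = 0}"
  have "ideal K A"
    unfolding A_def by (rule ideal_ring_of_type_algebraI) (auto simp: K_def zero add mult)
  hence K: "primeideal K A"
    by (rule primeidealI) (auto simp: A_def K_def one mult A.cring_axioms[unfolded A_def]
        set_eq_iff intro!: exI[of _ 1])
  have "red (of_nat n) = of_nat n" for n
    by (induction n) (auto simp: zero one add)
  \<comment> \<open>Mixed characteristic makes the kernel nonzero, hence equal to the unique nonzero
    prime ideal.\<close>
  hence "of_nat CHAR('k) \<in> K" by (simp add: K_def)
  moreover have "of_nat CHAR('k) \<noteq> (0::'r)"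
    using char by (simp add: of_nat_eq_0_iff_char_dvd)
  ultimately have K0: "K \<noteq> {0}" by auto
  have principal: "\<exists>a. I = {x. a dvd x}" if "ideal I A" for I
    using A.exists_gen[OF that] by (auto simp: A_def cgenideal_ring_of_type_algebra)
  then obtain p where p: "K = {x. p dvd x}" using \<open>ideal K A\<close> by blast
  have p_iff: "red x = 0 \<longleftrightarrow> p dvd x" for x using p by (auto simp: K_def)
  have p0: "p \<noteq> 0" using K0 p by auto
  have p_nonunit: "\<not> p dvd 1" using p_iff[of 1] by (simp add: one)
  have unit: "x dvd 1" if x: "red x \<noteq> 0" for x
  proof (rule ccontr)
    assume "\<not> x dvd 1"
    moreover have "x \<noteq> 0" using x zero by auto
    \<comment> \<open>An irreducible divisor of \<open>x\<close> generates a nonzero prime ideal,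
      which must be \<open>K\<close>; then \<open>x\<close> lies in \<open>K\<close>.\<close>
    ultimately obtain q where q: "q \<in> carrier A" "ring_irreducible\<^bsub>A\<^esub> q" "q divides\<^bsub>A\<^esub> x"
      using A.exists_irreducible_divisor[of x]
      by (auto simp: A_def Units_ring_of_type_algebra)
    have "primeideal (PIdl\<^bsub>A\<^esub> q) A"
      by (intro A.maximalideal_prime A.irreducible_imp_maximalideal q)
    moreover have "q \<noteq> 0" using q(2) by (simp add: ring_irreducible_def A_def)
    moreover have "q \<in> PIdl\<^bsub>A\<^esub> q" by (simp add: A_def cgenideal_ring_of_type_algebra)
    ultimately have "primeideal (PIdl\<^bsub>A\<^esub> q) A" "PIdl\<^bsub>A\<^esub> q \<noteq> {0}" by auto
    hence "PIdl\<^bsub>A\<^esub> q = K" using unique K K0 by blast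
    moreover have "x \<in> PIdl\<^bsub>A\<^esub> q"
      using q(3) by (auto simp: A_def cgenideal_ring_of_type_algebra factor_def)
    ultimately show False using x by (simp add: K_def)
  qed
  have finite_val: "\<exists>n. \<not> p ^ n dvd x" if "x \<noteq> 0" for x
  proof (rule ccontr)
    assume "\<nexists>n. \<not> p ^ n dvd x"
    hence "\<forall>n. \<exists>y. x = p ^ n * y" by (auto simp: dvd_def)
    then obtain y where y: "\<And>n. x = p ^ n * y n" by metis
    \<comment> \<open>\<open>J\<close> is the union of the ascending chain of ideals generated by
      the \<open>y n\<close>. Being principal, it makes the chain stationary, while
      \<open>y n = p * y (Suc n)\<close> with \<open>p\<close> not a unit.\<close>
    define J where "J = {a. \<exists>n. x dvd p ^ n * a}"
    have mono: "x dvd p ^ (m + n) * a" if "x dvd p ^ n * a" for m n a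
      using dvd_mult[OF that, of "p ^ m"] by (simp add: power_add mult.assoc)
    have "ideal J A"
      unfolding A_def
    proof (rule ideal_ring_of_type_algebraI)
      fix a b assume "a \<in> J" "b \<in> J"
      then obtain m n where "x dvd p ^ m * a" "x dvd p ^ n * b" by (auto simp: J_def)
      hence "x dvd p ^ (n + m) * a + p ^ (m + n) * b" by (intro dvd_add mono)
      hence "x dvd p ^ (m + n) * (a + b)" by (simp add: distrib_left add.commute)
      thus "a + b \<in> J" by (auto simp: J_def)
    next
      fix a c assume "a \<in> J"
      then obtain m where "x dvd p ^ m * a" by (auto simp: J_def)
      hence "x dvd p ^ m * (c * a)" by (metis dvd_mult mult.left_commute)
      thus "c * a \<in> J" by (auto simp: J_def)
    qed (auto simp: J_def)
    then obtain j where j: "J = {a. j dvd a}" using principal by blast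
    hence "j \<in> J" by simp
    then obtain n where n: "x dvd p ^ n * j" by (auto simp: J_def)
    have pn: "p ^ n \<noteq> 0" using p0 by simp
    have "p ^ n * y n dvd p ^ n * j" using n y[of n] by metis
    hence "y n dvd j" using p0 by auto
    moreover have "y (Suc n) \<in> J"
      unfolding J_def using y[of "Suc n"] by (metis (mono_tags) dvd_refl mem_Collect_eq)
    hence "j dvd y (Suc n)" using j by simp
    ultimately have "y n dvd y (Suc n)" by (rule dvd_trans)
    moreover have "p ^ n * y n = p ^ n * (p * y (Suc n))"
      by (simp add: y[of n, symmetric] y[of "Suc n", symmetric, unfolded power_Suc2 mult.assoc])
    hence "y n = p * y (Suc n)" using pn mult_left_cancel by blast
    ultimately obtain c where "y (Suc n) * 1 = y (Suc n) * (p * c)"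
      by (auto simp: dvd_def mult_ac)
    moreover have "y (Suc n) \<noteq> 0" using y[of "Suc n"] \<open>x \<noteq> 0\<close> by auto
    ultimately have "1 = p * c" using mult_left_cancel by blast
    thus False using p_nonunit dvdI by blast
  qed
  show thesis
  proof (rule that)
    show "residue_hom red p"
    proof
      show "(2::'r) \<noteq> 0"
        using of_nat_eq_0_iff_char_dvd[of 2, where 'a='r] char by simp
      show "a = 0" if "\<And>n. p ^ n dvd a" for a
        using finite_val[of a] that by blast
    qed (fact add mult one p_iff unit)+
  next
    fix x :: 'r assume "x \<noteq> 0"
    \<comment> \<open>\<open>n\<close> is the valuation of \<open>x\<close> plus one; splitting off
      \<open>p ^ m\<close> leaves a unit.\<close>
    define n where "n = (LEAST n. \<not> p ^ n dvd x)"
    have n: "\<not> p ^ n dvd x" unfolding n_def by (rule LeastI_ex[OF finite_val[OF \<open>x \<noteq> 0\<close>]])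
    hence "n \<noteq> 0" by (intro notI) simp
    then obtain m where m: "n = Suc m" by (cases n) auto
    have "p ^ m dvd x" using not_less_Least[of m "\<lambda>n. \<not> p ^ n dvd x"] m by (simp add: n_def)
    then obtain w where w: "x = p ^ m * w" by (rule dvdE)
    have "\<not> p dvd w" using n by (auto simp: w m mult.commute mult_dvd_mono)
    hence "w dvd 1" using p_iff unit by blast
    from mult_dvd_mono[OF dvd_refl[of "p ^ m"] this] have "x dvd p ^ m" by (simp only: w mult_1_right)
    thus "\<exists>n. x dvd p ^ n" ..
  qed
qed

text \<open>No completeness is assumed of \<open>R\<close>, but an \<open>R\<close>-algebra endomorphism of \<open>R[[z]]\<close> sending
  \<open>z\<close> to a series with constant term \<open>c \<noteq> 0\<close> provides the limits of the series \<open>\<Sum>\<^sub>i x\<^sub>i c\<^sup>i\<close>.\<close>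

lemma (in residue_hom) complete_of_endo:
  assumes pow: "\<And>x. x \<noteq> 0 \<Longrightarrow> \<exists>n. x dvd p ^ n"
    and "fps_endo g" and nz: "g fps_X $ 0 \<noteq> 0" and red: "red (g fps_X $ 0) = 0"
  shows "complete_residue_hom red p"
proof
  interpret fps_endo g by fact
  define c where "c = g fps_X $ 0"
  have pc: "p dvd c" using red by (simp add: c_def red_eq_0_iff)
  obtain e where "c dvd p ^ e" using pow nz by (auto simp: c_def)
  hence e: "c dvd p ^ Suc e" by simp
  have limit: "\<exists>l. \<forall>N. c ^ N dvd l - (\<Sum>i<N. x i * c ^ i)" for x
  proof -
    define f where "f = Abs_fps x"
    have "c ^ N dvd g f $ 0 - (\<Sum>i<N. x i * c ^ i)" for N
    proof -
      \<comment> \<open>Only the finite truncation is expanded through \<open>g\<close>; the tail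
        contributes a multiple of \<open>c ^ N\<close> whatever its image is.\<close>
      have "f = (\<Sum>i<N. fps_const (x i) * fps_X ^ i) + fps_X ^ N * fps_shift N f"
        by (auto simp: fps_eq_iff f_def fps_sum_nth fps_X_power_mult_nth if_distrib cong: if_cong)
      hence "g f = g ((\<Sum>i<N. fps_const (x i) * fps_X ^ i) + fps_X ^ N * fps_shift N f)"
        by simp
      hence "g f $ 0 = (\<Sum>i<N. x i * c ^ i) + c ^ N * g (fps_shift N f) $ 0"
        by (simp add: hom_sum homs hom_const fps_sum_nth fps_power_zeroth c_def)
      thus ?thesis by simp
    qed
    thus ?thesis by blast
  qed
  fix x :: "nat \<Rightarrow> 'r"
  assume x: "\<And>n. p ^ n dvd x (Suc n) - x n"
  have diff: "p ^ m dvd x (m + k) - x m" for m k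
  proof (induction k)
    case (Suc k)
    have "p ^ m dvd x (Suc (m + k)) - x (m + k)"
      by (rule dvd_trans[OF _ x]) (simp add: le_imp_power_dvd)
    from dvd_add[OF this Suc] show ?case by simp
  qed simp
  \<comment> \<open>Along this subsequence consecutive differences are divisible by
    \<open>c ^ n\<close>. The positive exponent \<open>Suc e\<close> ensures that \<open>y N\<close>
    comes no earlier than \<open>x N\<close>.\<close>
  define y where "y n = x (Suc e * n)" for n
  have "c ^ n dvd y (Suc n) - y n" for n
  proof -
    have "c ^ n dvd (p ^ Suc e) ^ n" using e by (rule dvd_power_same)
    also have "\<dots> = p ^ (Suc e * n)" by (rule power_mult[symmetric])
    also have "\<dots> dvd y (Suc n) - y n"
      using diff[of "Suc e * n" "Suc e"] by (simp add: y_def algebra_simps)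
    finally show ?thesis .
  qed
  hence "\<forall>n. \<exists>w. y (Suc n) - y n = c ^ n * w" by (simp add: dvd_def)
  then obtain w where w: "\<And>n. y (Suc n) - y n = c ^ n * w n" by metis
  obtain l where l: "\<And>N. c ^ N dvd l - (\<Sum>i<N. w i * c ^ i)" using limit by blast
  have sum: "(\<Sum>i<N. w i * c ^ i) = y N - y 0" for N
  proof (induction N)
    case (Suc N)
    have "w N * c ^ N = y (Suc N) - y N" by (simp only: w mult.commute)
    thus ?case by (simp add: Suc)
  qed simp
  have "p ^ N dvd (l + y 0) - x N" for N
  proof -
    have "p ^ N dvd c ^ N" by (rule dvd_power_same[OF pc])
    also have "\<dots> dvd l - (y N - y 0)" using l[of N] by (simp only: sum)
    finally have "p ^ N dvd (l - (y N - y 0)) + (x (N + e * N) - x N)"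
      using diff by (rule dvd_add)
    thus ?thesis by (simp add: y_def algebra_simps)
  qed
  thus "\<exists>l. \<forall>n. p ^ n dvd l - x n" by blast
qed

text \<open>This provides the triviality hypotheses of \<open>no_common_fixed_locus\<close> for
  \<open>P = z\<close>.\<close>

lemma (in fps_endo) X_dvd_disp:
  assumes "g fps_X $ 0 = 0"
  shows "eqmod fps_X (g f) f"
proof -
  have X: "fps_X dvd h" if "h $ 0 = 0" for h :: "'a fps"
    using fps_X_power_dvdI[of 1 h] that by simp
  have f: "fps_X dvd f - fps_const (f $ 0)" by (rule X) simp
  from hom_dvd[OF this] have "fps_X dvd g f - fps_const (f $ 0)"
    using dvd_trans[OF X[OF assms]] by (simp add: homs hom_const)
  with f show ?thesis using eqmod_trans eqmod_sym unfolding eqmod_def[symmetric] by blast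
qed

lemma fps_X_power_dvdD: "fps_X ^ n dvd (f :: 'a::comm_ring_1 fps) \<Longrightarrow> k < n \<Longrightarrow> f $ k = 0"
  by (auto elim!: dvdE simp: fps_X_power_mult_nth)

lemma (in residue_hom) quaternion_endos_not_simple:
  assumes pow: "\<And>x. x \<noteq> 0 \<Longrightarrow> \<exists>n. x dvd p ^ n"
    and "quaternion_endos s r" "fps_endo s" "fps_endo r"
    and s0: "red (s fps_X $ 0) = 0" and r0: "red (r fps_X $ 0) = 0"
    and Rs: "subdegree (R (s fps_X - fps_X)) = 2"
    and Rr: "R (r fps_X - fps_X) \<noteq> 0" "R (r (s fps_X) - fps_X) \<noteq> 0"
    and Rss: "R (s (s fps_X) - fps_X) \<noteq> 0"
  shows False
proof -
  interpret quaternion_endos s r by fact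
  interpret s: fps_endo s by fact
  interpret r: fps_endo r by fact
  have "complete_residue_hom red p"
  proof (cases "s fps_X $ 0 = 0 \<and> r fps_X $ 0 = 0")
    case True
    \<comment> \<open>If both maps fix the origin, then \<open>z\<close> defines a common fixed
      locus, which is impossible. Otherwise one of them moves the origin and yields
      completeness.\<close>
    define h where "h = s (s fps_X) - fps_X"
    have "h \<noteq> 0" using Rss R_zero by (auto simp: h_def)
    hence "\<not> fps_X ^ Suc (subdegree h) dvd h"
      using fps_X_power_dvdD[of "Suc (subdegree h)" h "subdegree h"] by auto
    moreover have "fps_X dvd f" if "fps_X dvd 2 * f" for f :: "'r fps"
      using fps_X_power_dvdD[of 1 "2 * f" 0] fps_X_power_dvdI[of 1 f] that two_nonzero
      by (simp add: numeral_fps_const)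
    ultimately have False
      using no_common_fixed_locus[OF _ s.X_dvd_disp r.X_dvd_disp, of h] True ss_neg
      unfolding h_def by (metis fps_X_neq_zero)
    thus ?thesis ..
  next
    case False
    thus ?thesis using complete_of_endo[OF pow] s0 r0 s.fps_endo_axioms r.fps_endo_axioms by metis
  qed
  then interpret complete_residue_hom red p .
  have "R (s fps_X - fps_X) \<noteq> 0" using Rs by auto
  from weierstrass_preparation[OF this, unfolded Rs] obtain u P where
    u: "u dvd 1" "s fps_X - fps_X = u * P" and RP: "R P = fps_X ^ 2"
    and P: "\<And>n. n > 2 \<Longrightarrow> P $ n = 0" "P $ 2 = 1" by metis
  have "P = fps_X ^ 2 - fps_const (- (P $ 1)) * fps_X + fps_const (P $ 0)"
  proof (rule fps_ext)
    fix n :: nat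
    consider "n = 0" | "n = 1" | "n = 2" | "n > 2" by linarith
    thus "P $ n = (fps_X ^ 2 - fps_const (- (P $ 1)) * fps_X + fps_const (P $ 0)) $ n"
      by cases (auto simp: P fps_X_power_nth fps_X_nth)
  qed
  moreover have "red (P $ 0) = 0" "red (- (P $ 1)) = 0"
    using arg_cong[OF RP, of "\<lambda>f. f $ 0"] arg_cong[OF RP, of "\<lambda>f. f $ 1"]
    by (simp_all add: R_nth red_uminus fps_X_power_nth)
  ultimately have "two_fixed_points red p s u P (- (P $ 1)) (P $ 0)"
    by unfold_locales (use u in auto)
  then interpret quaternion_fps red p s u P "- (P $ 1)" "P $ 0" r
    by (intro quaternion_fps.intro quaternion_endos_axioms r.fps_endo_axioms
        quaternion_fps_axioms.intro Rss Rr)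
  show False by (rule no_lift[OF Rr(2)])
qed

section \<open>Actions in characteristic two\<close>

lemma fps_action_fps_endo:
  assumes "fps_action G \<phi>" "g \<in> carrier G"
  shows "fps_endo (\<phi> g :: 'a::comm_ring_1 fps \<Rightarrow> _)"
proof -
  have h: "\<phi> g \<in> ring_hom ring_of_type_algebra ring_of_type_algebra"
    "\<And>c. \<phi> g (fps_const c) = fps_const c"
    using assms by (auto simp: fps_action_def fps_algebra_aut_def)
  show ?thesis
    using ring_hom_add[OF h(1)] ring_hom_mult[OF h(1)] ring_hom_one[OF h(1)] h(2)
    by unfold_locales auto
qed

lemma fps_action_mult:
  assumes "fps_action G \<phi>" "g \<in> carrier G" "h \<in> carrier G"
  shows "\<phi> (g \<otimes>\<^bsub>G\<^esub> h) f = \<phi> g (\<phi> h f)"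
proof -
  interpret faithful_action G UNIV \<phi> using assms(1) by (simp add: fps_action_def)
  show ?thesis using composition_rule assms by simp
qed

lemma fps_action_one:
  assumes "fps_action G \<phi>"
  shows "\<phi> \<one>\<^bsub>G\<^esub> f = f"
proof -
  interpret faithful_action G UNIV \<phi> using assms(1) by (simp add: fps_action_def)
  show ?thesis using id_eq_one by (metis UNIV_I restrict_apply')
qed

context fps_endo
begin

text \<open>If \<open>c = g(z)(0)\<close> were nonzero, \<open>z - c\<close> would be a unit, but
  its image has constant term 0. No continuity enters.\<close>

lemma field_disp_nth_0:
  assumes "\<And>c::'a. c \<noteq> 0 \<Longrightarrow> c dvd 1"
  shows "g fps_X $ 0 = 0"
proof (rule ccontr)
  define c where "c = g fps_X $ 0"
  assume "g fps_X $ 0 \<noteq> 0"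
  hence "fps_X - fps_const c dvd 1"
    using assms[of "- c"] by (intro fps_unitI) (simp add: c_def)
  from hom_dvd[OF this] have "g fps_X - fps_const c dvd 1" by (simp add: homs hom_const)
  then obtain k where "1 = (g fps_X - fps_const c) * k" by (rule dvdE)
  from arg_cong[OF this, of "\<lambda>f. f $ 0"] show False by (simp add: c_def)
qed

text \<open>Continuity is again avoided: below any degree, \<open>f\<close> is a fixed polynomial
  plus a multiple of a high power of \<open>z\<close>.\<close>

lemma eq_id_of_fixes_X:
  assumes "g fps_X = fps_X"
  shows "g f = f"
proof (rule fps_ext)
  fix k
  define q where "q = fps_shift (Suc k) f"
  have f: "f = (\<Sum>i<Suc k. fps_const (f $ i) * fps_X ^ i) + fps_X ^ Suc k * q"
    by (auto simp: fps_eq_iff q_def fps_sum_nth fps_X_power_mult_nth if_distrib not_less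
        simp del: power_Suc sum.lessThan_Suc cong: if_cong)
  have "g f = (\<Sum>i<Suc k. fps_const (f $ i) * fps_X ^ i) + fps_X ^ Suc k * g q"
    by (subst f) (simp only: hom_sum hom_add hom_mult hom_power hom_const assms)
  hence "g f - f = fps_X ^ Suc k * (g q - q)"
    by (subst (2) f) (simp add: algebra_simps del: power_Suc sum.lessThan_Suc)
  hence "fps_X ^ Suc k dvd g f - f" by simp
  from fps_X_power_dvdD[OF this, of k] show "g f $ k = f $ k" by simp
qed

end

text \<open>The chain rule at the origin.\<close>

lemma fps_endo_comp_linear_coeff:
  assumes "fps_endo g" "g fps_X $ 0 = 0" "h $ 0 = 0"
  shows "g h $ 1 = g fps_X $ 1 * h $ 1"
proof -
  interpret fps_endo g by fact
  have h: "h = fps_X * fps_shift 1 h"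
    using assms(3) by (simp add: fps_eq_iff)
  define q where "q = fps_shift 1 h"
  have "g h = g fps_X * g q"
    unfolding q_def by (subst h) (rule hom_mult)
  moreover have "fps_X dvd g q - q"
    using X_dvd_disp[OF assms(2)] by (simp add: eqmod_def)
  hence "g q $ 0 = q $ 0"
    using fps_X_power_dvdD[of 1 "g q - q" 0] by simp
  ultimately show ?thesis
    using assms(2) by (simp add: fps_mult_nth q_def)
qed

text \<open>The linear coefficient \<open>c\<close> is a root of unity of 2-power order; in
  characteristic 2 the power map is additive, so \<open>c = 1\<close>.\<close>

lemma fps_action_disp:
  fixes \<phi> :: "'g \<Rightarrow> 'k::field fps \<Rightarrow> 'k fps"
  assumes act: "fps_action G \<phi>" and g: "g \<in> carrier G" "g \<noteq> \<one>\<^bsub>G\<^esub>"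
    and char: "CHAR('k) = 2" and order: "Coset.order G = 2 ^ m"
  shows "\<phi> g fps_X - fps_X \<noteq> 0" "subdegree (\<phi> g fps_X - fps_X) \<ge> 2"
proof -
  interpret faithful_action G UNIV \<phi> using act by (simp add: fps_action_def)
  interpret group G using group_hom by (simp add: group_hom_def)
  have fin: "finite (carrier G)"
    using order by (simp add: Coset.order_def card_ge_0_finite)
  have e: "fps_endo (\<phi> h)" if "h \<in> carrier G" for h
    by (rule fps_action_fps_endo[OF act that])
  have X0: "\<phi> h fps_X $ 0 = 0" if "h \<in> carrier G" for h
    using fps_endo.field_disp_nth_0[OF e[OF that]] by (simp add: dvd_field_iff)
  show nz: "\<phi> g fps_X - fps_X \<noteq> 0"
  proof
    assume "\<phi> g fps_X - fps_X = 0"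
    hence "\<phi> g f = f" for f using fps_endo.eq_id_of_fixes_X[OF e[OF g(1)]] by simp
    hence "\<phi> g = \<phi> \<one>\<^bsub>G\<^esub>" using fps_action_one[OF act] by (simp add: fun_eq_iff)
    thus False using faithful g by (auto dest: inj_onD)
  qed
  define c where "c = \<phi> g fps_X $ 1"
  have pow: "\<phi> (g [^]\<^bsub>G\<^esub> i) fps_X $ 1 = c ^ i" for i :: nat
  proof (induction i)
    case 0
    thus ?case by (simp add: fps_action_one[OF act])
  next
    case (Suc i)
    have "\<phi> (g [^]\<^bsub>G\<^esub> i \<otimes>\<^bsub>G\<^esub> g) fps_X = \<phi> (g [^]\<^bsub>G\<^esub> i) (\<phi> g fps_X)"
      by (rule fps_action_mult[OF act]) (use g in auto)
    thus ?case
      using fps_endo_comp_linear_coeff[OF e X0 X0, of "g [^]\<^bsub>G\<^esub> i" g] g Suc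
      by (simp add: c_def)
  qed
  have "g [^]\<^bsub>G\<^esub> Coset.order G = \<one>\<^bsub>G\<^esub>"
    using g(1) by (rule pow_order_eq_1)
  hence "c ^ 2 ^ m = 1"
    using pow[of "Coset.order G"] by (simp add: order fps_action_one[OF act])
  moreover have two: "(2::'k) = 0"
    using of_nat_CHAR[where 'a='k] by (simp add: char)
  moreover have "(c + 1) ^ 2 ^ m = c ^ 2 ^ m + 1 ^ 2 ^ m"
    using freshmans_dream'[where x = c and y = 1 and m = "2 ^ m" and n = m] char by simp
  ultimately have "(c + 1) ^ 2 ^ m = 0" by simp
  hence "c + 1 = 0" by simp
  hence "c = 1" using two by (metis add_right_cancel one_add_one)
  show "subdegree (\<phi> g fps_X - fps_X) \<ge> 2"
  proof (rule subdegree_geI[OF nz])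
    fix i :: nat assume "i < 2"
    hence "i = 0 \<or> i = 1" by linarith
    thus "(\<phi> g fps_X - fps_X) $ i = 0"
      using X0[OF g(1)] \<open>c = 1\<close> by (auto simp: c_def)
  qed
qed

section \<open>Generalized quaternion groups\<close>

context generalized_quaternion
begin

lemma \<tau>_pow_mod: "\<tau> [^] (a mod 2 ^ n :: nat) = \<tau> [^] a"
proof -
  have "\<tau> [^] a = \<tau> [^] (2 ^ n * (a div 2 ^ n) + a mod 2 ^ n)" by simp
  also have "\<dots> = (\<tau> [^] ((2::nat) ^ n)) [^] (a div 2 ^ n) \<otimes> \<tau> [^] (a mod 2 ^ n)"
    using \<tau>_closed by (simp only: nat_pow_mult nat_pow_pow)
  finally show ?thesis using \<tau>_closed by (simp add: \<tau>_pow)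
qed

lemma inv_\<tau>: "inv \<tau> = \<tau> [^] ((2::nat) ^ n - 1)"
proof (rule inv_equality)
  have "\<tau> [^] ((2::nat) ^ n - 1) \<otimes> \<tau> = \<tau> [^] Suc (2 ^ n - 1)"
    by (rule nat_pow_Suc[symmetric])
  also have "Suc (2 ^ n - 1) = 2 ^ n" by simp
  finally show "\<tau> [^] ((2::nat) ^ n - 1) \<otimes> \<tau> = \<one>" by (simp only: \<tau>_pow)
qed (use \<tau>_closed in auto)

lemma \<sigma>_\<tau>: "\<sigma> \<otimes> \<tau> = \<tau> [^] ((2::nat) ^ n - 1) \<otimes> \<sigma>"
proof -
  have "\<sigma> \<otimes> \<tau> = (\<sigma> \<otimes> \<tau> \<otimes> inv \<sigma>) \<otimes> \<sigma>"
    using \<sigma>_closed \<tau>_closed by (simp add: m_assoc)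
  thus ?thesis by (simp only: conj_\<tau> inv_\<tau>)
qed

lemma \<sigma>_\<tau>_pow: "\<sigma> \<otimes> \<tau> [^] (a::nat) = \<tau> [^] ((2 ^ n - 1) * a) \<otimes> \<sigma>"
proof (induction a)
  case (Suc a)
  define M :: nat where "M = 2 ^ n - 1"
  have "\<sigma> \<otimes> \<tau> [^] Suc a = (\<sigma> \<otimes> \<tau> [^] a) \<otimes> \<tau>"
    using \<sigma>_closed \<tau>_closed by (simp add: m_assoc)
  also have "\<dots> = \<tau> [^] (M * a) \<otimes> (\<sigma> \<otimes> \<tau>)"
    using \<sigma>_closed \<tau>_closed by (simp add: Suc m_assoc M_def)
  also have "\<dots> = (\<tau> [^] (M * a) \<otimes> \<tau> [^] M) \<otimes> \<sigma>"
    using \<sigma>_closed \<tau>_closed by (simp add: \<sigma>_\<tau> m_assoc M_def)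
  also have "\<tau> [^] (M * a) \<otimes> \<tau> [^] M = \<tau> [^] (M * Suc a)"
    using \<tau>_closed by (simp add: nat_pow_mult add.commute)
  finally show ?case by (simp only: M_def)
qed (use \<sigma>_closed in simp)

lemma \<sigma>_\<sigma>: "\<sigma> \<otimes> \<sigma> = \<tau> [^] ((2::nat) ^ (n - 1))"
  unfolding \<tau>_pow_half using \<sigma>_closed by (simp add: numeral_2_eq_2)

text \<open>The set \<open>S\<close> of normal forms contains the identity and is stable under left
  multiplication by the generators and their inverses.\<close>

lemma carrier_subset:
  "carrier G \<subseteq> (\<lambda>(a, b). \<tau> [^] a \<otimes> \<sigma> [^] b) ` ({..<2 ^ n :: nat} \<times> {..<2::nat})"
proof -
  define S where "S = {\<tau> [^] (a::nat) \<otimes> \<sigma> [^] (b::nat) | a b. b < 2}"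
  have mem: "\<tau> [^] a \<otimes> \<sigma> [^] b \<in> S" if "b < 2" for a b :: nat
    using that by (auto simp: S_def)
  have S: "\<tau> [^] (a::nat) \<otimes> \<sigma> \<in> S" "\<tau> [^] (a::nat) \<in> S" for a
    using mem[of 1 a] mem[of 0 a] \<sigma>_closed \<tau>_closed by simp_all
  have cases: "\<exists>a::nat. x = \<tau> [^] a \<or> x = \<tau> [^] a \<otimes> \<sigma>" if "x \<in> S" for x
    using that \<sigma>_closed \<tau>_closed unfolding S_def
    by (auto simp: numeral_2_eq_2 less_Suc_eq)
  have carr: "x \<in> carrier G" if "x \<in> S" for x
    using that \<sigma>_closed \<tau>_closed by (auto simp: S_def)
  have \<tau>S: "\<tau> [^] (m::nat) \<otimes> x \<in> S" if "x \<in> S" for x m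
    using cases[OF that] S \<sigma>_closed \<tau>_closed
    by (auto simp: nat_pow_mult m_assoc[symmetric])
  have \<sigma>S: "\<sigma> \<otimes> x \<in> S" if "x \<in> S" for x
  proof -
    obtain a :: nat where "x = \<tau> [^] a \<or> x = \<tau> [^] a \<otimes> \<sigma>" using cases[OF \<open>x \<in> S\<close>] by blast
    thus ?thesis
    proof
      assume "x = \<tau> [^] a"
      thus ?thesis using S by (simp add: \<sigma>_\<tau>_pow)
    next
      assume x: "x = \<tau> [^] a \<otimes> \<sigma>"
      have "\<sigma> \<otimes> x = (\<sigma> \<otimes> \<tau> [^] a) \<otimes> \<sigma>"
        using \<sigma>_closed \<tau>_closed by (simp add: x m_assoc)
      also have "\<dots> = \<tau> [^] ((2 ^ n - 1) * a) \<otimes> (\<sigma> \<otimes> \<sigma>)"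
        unfolding \<sigma>_\<tau>_pow using \<sigma>_closed \<tau>_closed by (simp add: m_assoc)
      finally show ?thesis unfolding \<sigma>_\<sigma> using \<tau>S S by metis
    qed
  qed
  have ss: "\<sigma> \<otimes> (\<sigma> \<otimes> x) = \<tau> [^] ((2::nat) ^ (n - 1)) \<otimes> x" if "x \<in> carrier G" for x
    using \<sigma>_closed that by (simp add: m_assoc[symmetric] \<sigma>_\<sigma>)
  have inv_\<sigma>S: "inv \<sigma> \<otimes> x \<in> S" if "x \<in> S" for x
  proof -
    \<comment> \<open>\<open>\<tau> [^] H\<close> is the inverse of \<open>\<sigma>^2\<close>, so
      the inverse of \<open>\<sigma>\<close> is
      \<open>\<sigma> \<otimes> \<tau> [^] H\<close>.\<close>
    define H :: nat where "H = 2 ^ n - 2 ^ (n - 1)"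
    have "2 ^ (n - 1) + H = (2::nat) ^ n" by (simp add: H_def power_increasing)
    hence "\<tau> [^] ((2::nat) ^ (n - 1)) \<otimes> (\<tau> [^] H \<otimes> x) = x"
      using \<tau>_closed carr[OF that] by (simp add: m_assoc[symmetric] nat_pow_mult \<tau>_pow)
    hence "\<sigma> \<otimes> (\<sigma> \<otimes> (\<tau> [^] H \<otimes> x)) = x"
      using ss[of "\<tau> [^] H \<otimes> x"] carr[OF that] \<tau>_closed by simp
    hence "inv \<sigma> \<otimes> x = \<sigma> \<otimes> (\<tau> [^] H \<otimes> x)"
      using inv_solve_left[of \<sigma> x "\<sigma> \<otimes> (\<tau> [^] H \<otimes> x)"] carr[OF that] \<sigma>_closed \<tau>_closed
      by (metis m_closed nat_pow_closed inv_solve_left)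
    thus ?thesis using \<sigma>S \<tau>S that by metis
  qed
  have gen: "h \<in> carrier G \<and> (\<forall>x\<in>S. h \<otimes> x \<in> S)" if "h \<in> generate G {\<sigma>, \<tau>}" for h
    using that
  proof (induction rule: generate.induct)
    case one
    show ?case using carr by simp
  next
    case (incl h)
    thus ?case using \<sigma>S \<tau>S[of _ 1] \<sigma>_closed \<tau>_closed by auto
  next
    case (inv h)
    thus ?case using inv_\<sigma>S \<tau>S \<sigma>_closed \<tau>_closed by (auto simp: inv_\<tau>)
  next
    case (eng h1 h2)
    thus ?case using carr by (auto simp: m_assoc)
  qed
  show ?thesis
  proof
    fix g assume g: "g \<in> carrier G"
    have "\<one> \<in> S" using S(2)[of 0] by simp
    hence "g \<in> S" using gen[of g] g generated by fastforce
    then obtain a b :: nat where ab: "g = \<tau> [^] a \<otimes> \<sigma> [^] b" "b < 2" by (auto simp: S_def)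
    hence "g = \<tau> [^] (a mod 2 ^ n) \<otimes> \<sigma> [^] b" by (simp add: \<tau>_pow_mod)
    thus "g \<in> (\<lambda>(a, b). \<tau> [^] a \<otimes> \<sigma> [^] b) ` ({..<2 ^ n :: nat} \<times> {..<2::nat})"
      using ab(2) by (intro image_eqI[of _ _ "(a mod 2 ^ n, b)"]) auto
  qed
qed

text \<open>By \<open>order_eq\<close> the normal forms are exactly as many as the group elements,
  so surjectivity suffices.\<close>

lemma carrier_bij:
  "bij_betw (\<lambda>(a, b). \<tau> [^] a \<otimes> \<sigma> [^] b) ({..<2 ^ n :: nat} \<times> {..<2::nat}) (carrier G)"
proof -
  have eq: "(\<lambda>(a, b). \<tau> [^] a \<otimes> \<sigma> [^] b) ` ({..<2 ^ n :: nat} \<times> {..<2::nat}) = carrier G"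
    using carrier_subset \<sigma>_closed \<tau>_closed by auto
  moreover have "card ({..<2 ^ n :: nat} \<times> {..<2::nat}) = card (carrier G)"
    using order_eq by (simp add: Coset.order_def card_cartesian_product mult.commute)
  ultimately show ?thesis
    by (intro bij_betw_imageI eq_card_imp_inj_on) simp_all
qed

lemma sum_carrier:
  "(\<Sum>g\<in>carrier G. h g) = (\<Sum>a<(2::nat) ^ n. h (\<tau> [^] (a::nat)) + h (\<tau> [^] a \<otimes> \<sigma>))"
proof -
  have "(\<Sum>g\<in>carrier G. h g) =
      (\<Sum>(a, b)\<in>{..<2 ^ n :: nat} \<times> {..<2::nat}. h (\<tau> [^] a \<otimes> \<sigma> [^] b))"
    using sum.reindex_bij_betw[OF carrier_bij, of h] by (simp add: case_prod_unfold)
  also have "\<dots> = (\<Sum>a<(2::nat) ^ n. \<Sum>b<2::nat. h (\<tau> [^] a \<otimes> \<sigma> [^] b))"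
    by (rule sum.cartesian_product[symmetric])
  finally show ?thesis
    using \<sigma>_closed \<tau>_closed by (simp add: numeral_2_eq_2 lessThan_Suc add.commute)
qed

lemma \<tau>_pow_eq_one_iff:
  assumes "a < 2 ^ n"
  shows "\<tau> [^] (a::nat) = \<one> \<longleftrightarrow> a = 0"
  using bij_betw_imp_inj_on[OF carrier_bij, THEN inj_onD, of "(a, 0)" "(0, 0)"] assms \<tau>_closed
  by auto

text \<open>Take \<open>\<rho>\<close> to be \<tau> to the power \<open>2 ^ (n - 2)\<close>. The
  last relation says, without inverses, that \<sigma> inverts \<rho>.\<close>

lemma quaternion_subgroup:
  assumes "n \<ge> 2"
  obtains \<rho> where "\<rho> \<in> carrier G" "\<rho> \<otimes> \<rho> = \<sigma> \<otimes> \<sigma>" "\<sigma> \<otimes> \<sigma> \<noteq> \<one>"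
    "\<sigma> \<otimes> \<sigma> \<otimes> (\<sigma> \<otimes> \<sigma>) = \<one>" "\<rho> \<otimes> \<sigma> \<otimes> \<rho> = \<sigma>"
proof
  define j :: nat where "j = 2 ^ (n - 2)"
  define \<rho> where "\<rho> = \<tau> [^] j"
  obtain m where m: "n = Suc (Suc m)"
    using assms by (metis Suc_le_D numeral_2_eq_2 Suc_le_mono)
  show "\<rho> \<in> carrier G" using \<tau>_closed by (simp add: \<rho>_def)
  show "\<rho> \<otimes> \<rho> = \<sigma> \<otimes> \<sigma>"
    using \<tau>_closed by (simp add: \<rho>_def \<sigma>_\<sigma> nat_pow_mult j_def m mult_2)
  show "\<sigma> \<otimes> \<sigma> \<noteq> \<one>"
    unfolding \<sigma>_\<sigma> by (subst \<tau>_pow_eq_one_iff) (simp_all add: m)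
  show "\<sigma> \<otimes> \<sigma> \<otimes> (\<sigma> \<otimes> \<sigma>) = \<one>"
    using \<tau>_closed \<tau>_pow by (simp add: \<sigma>_\<sigma> nat_pow_mult m)
  have "\<rho> \<otimes> \<sigma> \<otimes> \<rho> = \<tau> [^] j \<otimes> (\<tau> [^] ((2 ^ n - 1) * j) \<otimes> \<sigma>)"
    using \<sigma>_closed \<tau>_closed by (simp add: \<rho>_def m_assoc \<sigma>_\<tau>_pow)
  also have "\<dots> = \<tau> [^] (j + (2 ^ n - 1) * j) \<otimes> \<sigma>"
    using \<sigma>_closed \<tau>_closed by (simp add: m_assoc[symmetric] nat_pow_mult)
  also have "j + (2 ^ n - 1) * j = 2 ^ n * j"
    by (simp add: algebra_simps)
  also have "\<tau> [^] (2 ^ n * j) = \<one>"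
    using \<tau>_closed \<tau>_pow by (simp add: nat_pow_pow[symmetric])
  finally show "\<rho> \<otimes> \<sigma> \<otimes> \<rho> = \<sigma>" using \<sigma>_closed by simp
qed

end

section \<open>Artin characters of simple actions\<close>

lemma (in group) order_two_character_one:
  "order_two_character G \<chi> \<Longrightarrow> \<chi> \<one> = 1"
  unfolding order_two_character_def by (metis mult_cancel_left1 one_closed l_one
    insertE singletonD zero_neq_neg_one zero_neq_one)

lemma (in group) order_two_character_pow:
  assumes "order_two_character G \<chi>" "x \<in> carrier G"
  shows "\<chi> (x [^] (a::nat)) = \<chi> x ^ a"
  using assms order_two_character_one[OF assms(1)]
  by (induction a) (auto simp: order_two_character_def mult.commute)

text \<open>The value of the Artin character at the identity is the sum of all orders, which creates
  the weights \<open>1 - \<chi> g\<close>; the identity itself gets weight 0.\<close>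

lemma (in group) artin_pairing_eq:
  assumes act: "fps_action G \<phi>" and \<chi>: "order_two_character G \<chi>" and fin: "finite (carrier G)"
  shows "artin_pairing G \<phi> \<chi> * of_nat (Coset.order G) =
    (\<Sum>g\<in>carrier G. (1 - \<chi> g) * of_nat (subdegree (\<phi> g fps_X - fps_X)))"
proof -
  define f where "f g = subdegree (\<phi> g fps_X - fps_X)" for g
  have cnj: "cnj (\<chi> g) = \<chi> g" if "g \<in> carrier G" for g
    using \<chi> that by (auto simp: order_two_character_def)
  have split: "sum h (carrier G) = h \<one> + sum h (carrier G - {\<one>})" for h :: "'a \<Rightarrow> complex"
    by (rule sum.remove[OF fin one_closed])
  have "Coset.order G > 0"
    using fin one_closed by (auto simp: Coset.order_def card_gt_0_iff)
  hence "artin_pairing G \<phi> \<chi> * of_nat (Coset.order G) =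
      (\<Sum>g\<in>carrier G. cnj (\<chi> g) * of_int (artin_char G \<phi> g))"
    by (simp add: artin_pairing_def)
  also have "\<dots> = of_int (artin_char G \<phi> \<one>)
      + (\<Sum>g\<in>carrier G - {\<one>}. \<chi> g * of_int (artin_char G \<phi> g))"
    by (subst split) (simp add: cnj order_two_character_one[OF \<chi>])
  also have "\<dots> = (\<Sum>g\<in>carrier G - {\<one>}. (1 - \<chi> g) * of_nat (f g))"
    by (simp add: artin_char_def f_def sum_negf algebra_simps sum.distrib sum_subtractf)
  also have "\<dots> = (\<Sum>g\<in>carrier G. (1 - \<chi> g) * of_nat (f g))"
    by (subst split) (simp add: order_two_character_one[OF \<chi>])
  finally show ?thesis by (simp add: f_def)
qed

context generalized_quaternion
begin

text \<open>The combination \<open>\<chi>\<^sub>0 + \<chi>\<^sub>2 - \<chi>\<^sub>1\<close> of the three characters isolates the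
  conjugacy class \<open>{\<tau>\<^sup>a \<sigma> | a even}\<close> of \<open>\<sigma>\<close>.\<close>

lemma simple_action_subdegree:
  fixes \<phi> :: "'a \<Rightarrow> 'k::field fps \<Rightarrow> 'k fps"
  assumes simple: "simple_action G \<sigma> \<tau> \<phi>" and char: "CHAR('k) = 2" and "n \<ge> 1"
  shows "subdegree (\<phi> \<sigma> fps_X - fps_X) = 2"
proof -
  obtain \<chi>0 \<chi>1 \<chi>2 where act: "fps_action G \<phi>"
    and \<chi>: "order_two_character G \<chi>0" "order_two_character G \<chi>1" "order_two_character G \<chi>2"
    and ker: "generate G {\<tau>} \<subseteq> character_kernel G \<chi>0"
      "generate G {\<sigma>} \<subseteq> character_kernel G \<chi>1"
      "generate G {\<sigma> \<otimes> \<tau>} \<subseteq> character_kernel G \<chi>2"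
    and pair: "artin_pairing G \<phi> \<chi>0 = 2" "artin_pairing G \<phi> \<chi>1 = artin_pairing G \<phi> \<chi>2"
    using simple unfolding simple_action_def by blast
  have fin: "finite (carrier G)"
    using order_eq by (simp add: Coset.order_def card_ge_0_finite)
  have mult: "\<chi> (g \<otimes> h) = \<chi> g * \<chi> h"
    if "order_two_character G \<chi>" "g \<in> carrier G" "h \<in> carrier G" for \<chi> g h
    using that by (simp add: order_two_character_def)
  have val: "\<chi> g = 1 \<or> \<chi> g = -1" if "order_two_character G \<chi>" "g \<in> carrier G" for \<chi> g
    using that by (auto simp: order_two_character_def)
  have nontriv: "\<chi> \<sigma> \<noteq> 1 \<or> \<chi> \<tau> \<noteq> 1" if \<chi>: "order_two_character G \<chi>" for \<chi>
  proof (rule ccontr)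
    assume "\<not> ?thesis"
    hence 1: "\<chi> \<sigma> = 1" "\<chi> \<tau> = 1" by auto
    have "\<chi> g = 1" if "g \<in> carrier G" for g
      using subsetD[OF carrier_subset that] \<sigma>_closed \<tau>_closed
      by (auto simp: mult[OF \<chi>] order_two_character_pow[OF \<chi>] 1)
    thus False using \<chi> by (auto simp: order_two_character_def)
  qed
  have "\<chi>0 \<tau> = 1" using ker(1) generate.incl[of \<tau> "{\<tau>}" G] by (auto simp: character_kernel_def)
  moreover hence "\<chi>0 \<sigma> = -1" using nontriv val \<chi>(1) \<sigma>_closed by metis
  ultimately have \<chi>0: "\<chi>0 (\<tau> [^] a) = 1" "\<chi>0 (\<tau> [^] a \<otimes> \<sigma>) = -1" for a :: nat
    using \<sigma>_closed \<tau>_closed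
    by (simp_all add: mult[OF \<chi>(1)] order_two_character_pow[OF \<chi>(1)])
  have "\<chi>1 \<sigma> = 1" using ker(2) generate.incl[of \<sigma> "{\<sigma>}" G] by (auto simp: character_kernel_def)
  moreover hence "\<chi>1 \<tau> = -1" using nontriv val \<chi>(2) \<tau>_closed by metis
  ultimately have \<chi>1: "\<chi>1 (\<tau> [^] a) = (-1) ^ a" "\<chi>1 (\<tau> [^] a \<otimes> \<sigma>) = (-1) ^ a" for a :: nat
    using \<sigma>_closed \<tau>_closed
    by (simp_all add: mult[OF \<chi>(2)] order_two_character_pow[OF \<chi>(2)])
  have "\<chi>2 \<sigma> * \<chi>2 \<tau> = 1"
    using ker(3) generate.incl[of "\<sigma> \<otimes> \<tau>" "{\<sigma> \<otimes> \<tau>}" G] mult[OF \<chi>(3)] \<sigma>_closed \<tau>_closed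
    by (auto simp: character_kernel_def)
  hence "\<chi>2 \<sigma> = -1" "\<chi>2 \<tau> = -1"
    using nontriv[OF \<chi>(3)] val[OF \<chi>(3)] \<sigma>_closed \<tau>_closed by fastforce+
  hence \<chi>2: "\<chi>2 (\<tau> [^] a) = (-1) ^ a" "\<chi>2 (\<tau> [^] a \<otimes> \<sigma>) = - ((-1) ^ a)" for a :: nat
    using \<sigma>_closed \<tau>_closed
    by (simp_all add: mult[OF \<chi>(3)] order_two_character_pow[OF \<chi>(3)])
  define f where "f g = subdegree (\<phi> g fps_X - fps_X)" for g
  \<comment> \<open>This is \<open>(1 - \<chi>0) + (1 - \<chi>2) - (1 - \<chi>1)\<close> on
    \<open>\<tau> [^] a \<otimes> \<sigma>\<close>, which is 4 for even \<open>a\<close> and 0 for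
    odd \<open>a\<close>; on powers of \<tau> the combination vanishes.\<close>
  define w :: "nat \<Rightarrow> int" where "w a = 2 + 2 * (-1) ^ a" for a
  have "of_int (\<Sum>a<2 ^ n. w a * int (f (\<tau> [^] a \<otimes> \<sigma>))) =
      (\<Sum>g\<in>carrier G. (1 - \<chi>0 g) * of_nat (f g)) + (\<Sum>g\<in>carrier G. (1 - \<chi>2 g) * of_nat (f g))
      - (\<Sum>g\<in>carrier G. (1 - \<chi>1 g) * of_nat (f g))"
    unfolding sum_carrier sum.distrib[symmetric] sum_subtractf[symmetric] of_int_sum
    by (intro sum.cong refl) (simp add: \<chi>0 \<chi>1 \<chi>2 w_def algebra_simps)
  also have "\<dots> = (artin_pairing G \<phi> \<chi>0 + artin_pairing G \<phi> \<chi>2 - artin_pairing G \<phi> \<chi>1)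
      * of_nat (Coset.order G)"
    using artin_pairing_eq[OF act \<chi>(1) fin] artin_pairing_eq[OF act \<chi>(2) fin]
      artin_pairing_eq[OF act \<chi>(3) fin]
    by (simp add: f_def algebra_simps)
  also have "\<dots> = of_int (4 * 2 ^ n)" by (simp add: pair order_eq)
  finally have "(\<Sum>a<2 ^ n. w a * int (f (\<tau> [^] a \<otimes> \<sigma>))) = 4 * 2 ^ n"
    by (simp only: of_int_eq_iff)
  moreover have "(\<Sum>a<2 * m. w a) = 4 * int m" for m
    by (induction m) (simp_all add: w_def)
  from this[of "2 ^ (n - 1)"] have "(\<Sum>a<2 ^ n. w a * 2) = 4 * 2 ^ n"
    using \<open>n \<ge> 1\<close> by (cases n) (simp_all flip: sum_distrib_right)
  \<comment> \<open>The weighted average of the orders is 2, while each order is at least 2, so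
    equality holds wherever the weight is positive.\<close>
  ultimately have "(\<Sum>a<2 ^ n. w a * (int (f (\<tau> [^] a \<otimes> \<sigma>)) - 2)) = 0"
    by (simp add: right_diff_distrib sum_subtractf)
  moreover have "w a * (int (f (\<tau> [^] a \<otimes> \<sigma>)) - 2) \<ge> 0" for a
  proof -
    have "\<tau> [^] a \<otimes> \<sigma> \<noteq> \<one>"
      using \<chi>0(2)[of a] order_two_character_one[OF \<chi>(1)] by auto
    hence "f (\<tau> [^] a \<otimes> \<sigma>) \<ge> 2"
      unfolding f_def using \<sigma>_closed \<tau>_closed
      by (intro fps_action_disp(2)[OF act _ _ char order_eq]) auto
    moreover have "w a \<ge> 0" by (cases "even a") (simp_all add: w_def)
    ultimately show ?thesis by simp
  qed
  ultimately have "\<forall>a\<in>{..<2 ^ n}. w a * (int (f (\<tau> [^] a \<otimes> \<sigma>)) - 2) = 0"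
    by (subst (asm) sum_nonneg_eq_0_iff) auto
  from bspec[OF this, of 0] show ?thesis
    using \<sigma>_closed by (simp add: w_def f_def)
qed

end

section \<open>A putative lift restricted to a quaternion subgroup of order 8\<close>

theorem theorem4p8:
  fixes G :: "('g, 'm) monoid_scheme" and \<sigma> \<tau> :: 'g and n :: nat
    and \<phi> :: "'g \<Rightarrow> 'k::alg_closed_field fps \<Rightarrow> 'k fps"
  assumes "CHAR('k) = 2"
    and "n \<ge> 2"
    and "generalized_quaternion G \<sigma> \<tau> n"
    and "simple_action G \<sigma> \<tau> \<phi>"
  shows "\<not> lifts_over TYPE('r::idom) G \<phi>"
proof
  assume "lifts_over TYPE('r) G \<phi>"
  then obtain red :: "'r \<Rightarrow> 'k" and \<psi> :: "'g \<Rightarrow> 'r fps \<Rightarrow> 'r fps" where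
    dvr: "discrete_valuation_ring (ring_of_type_algebra :: 'r ring)" "CHAR('r) = 0"
    and red: "red \<in> ring_hom ring_of_type_algebra ring_of_type_algebra"
    and \<psi>: "fps_action G \<psi>"
    and lift: "\<And>g f. g \<in> carrier G \<Longrightarrow> fps_reduce red (\<psi> g f) = \<phi> g (fps_reduce red f)"
    unfolding lifts_over_def by blast
  interpret generalized_quaternion G \<sigma> \<tau> n by fact
  have \<phi>: "fps_action G \<phi>" using assms(4) by (simp add: simple_action_def)
  have "CHAR('k) \<noteq> 0" using assms(1) by simp
  from discrete_valuation_ring_residue_hom[OF dvr(1) red dvr(2) this] obtain p
    where "residue_hom red p" and pow: "\<And>x. x \<noteq> 0 \<Longrightarrow> \<exists>n. x dvd p ^ n" by blast
  then interpret residue_hom red p by simp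
  obtain \<rho> where \<rho>: "\<rho> \<in> carrier G" "\<rho> \<otimes>\<^bsub>G\<^esub> \<rho> = \<sigma> \<otimes>\<^bsub>G\<^esub> \<sigma>" "\<sigma> \<otimes>\<^bsub>G\<^esub> \<sigma> \<noteq> \<one>\<^bsub>G\<^esub>"
    "\<sigma> \<otimes>\<^bsub>G\<^esub> \<sigma> \<otimes>\<^bsub>G\<^esub> (\<sigma> \<otimes>\<^bsub>G\<^esub> \<sigma>) = \<one>\<^bsub>G\<^esub>" "\<rho> \<otimes>\<^bsub>G\<^esub> \<sigma> \<otimes>\<^bsub>G\<^esub> \<rho> = \<sigma>"
    using quaternion_subgroup[OF assms(2)] by blast
  note closed = \<sigma>_closed \<rho>(1) m_closed
  have comp: "\<psi> g (\<psi> h f) = \<psi> (g \<otimes>\<^bsub>G\<^esub> h) f" if "g \<in> carrier G" "h \<in> carrier G" for g h f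
    using fps_action_mult[OF \<psi> that] by simp
  have disp: "R (\<psi> g fps_X - fps_X) = \<phi> g fps_X - fps_X" if "g \<in> carrier G" for g
    by (simp add: R_diff R_X lift that)
  have nz: "R (\<psi> g fps_X - fps_X) \<noteq> 0" if "g \<in> carrier G" "g \<noteq> \<one>\<^bsub>G\<^esub>" for g
    using fps_action_disp(1)[OF \<phi> that assms(1) order_eq] by (simp add: disp that)
  \<comment> \<open>The lifted maps may move the origin, but only inside the maximal ideal.\<close>
  have X0: "red (\<psi> g fps_X $ 0) = 0" if "g \<in> carrier G" for g
  proof -
    interpret fps_endo "\<phi> g" by (rule fps_action_fps_endo[OF \<phi> that])
    have "\<phi> g fps_X $ 0 = 0" by (rule field_disp_nth_0) (simp add: dvd_field_iff)
    thus ?thesis using lift[OF that, of fps_X] by (simp add: R_X flip: R_nth)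
  qed
  have "\<rho> \<noteq> \<one>\<^bsub>G\<^esub>" using \<rho> by auto
  moreover have "\<rho> \<otimes>\<^bsub>G\<^esub> \<sigma> \<noteq> \<one>\<^bsub>G\<^esub>"
  proof
    assume eq: "\<rho> \<otimes>\<^bsub>G\<^esub> \<sigma> = \<one>\<^bsub>G\<^esub>"
    hence "\<rho> = \<sigma>" using \<rho>(1,5) by simp
    thus False using eq \<rho>(3) by simp
  qed
  moreover have "quaternion_endos (\<psi> \<sigma>) (\<psi> \<rho>)"
  proof -
    \<comment> \<open>Multiplied by \<rho> on the right, both sides become \<sigma>.\<close>
    have "\<rho> \<otimes>\<^bsub>G\<^esub> \<sigma> = \<sigma> \<otimes>\<^bsub>G\<^esub> (\<sigma> \<otimes>\<^bsub>G\<^esub> (\<sigma> \<otimes>\<^bsub>G\<^esub> \<rho>))"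
    proof (rule r_cancel[of _ \<rho>])
      have "\<sigma> \<otimes>\<^bsub>G\<^esub> (\<sigma> \<otimes>\<^bsub>G\<^esub> (\<sigma> \<otimes>\<^bsub>G\<^esub> \<rho>)) \<otimes>\<^bsub>G\<^esub> \<rho> = \<sigma> \<otimes>\<^bsub>G\<^esub> (\<sigma> \<otimes>\<^bsub>G\<^esub> (\<sigma> \<otimes>\<^bsub>G\<^esub> (\<rho> \<otimes>\<^bsub>G\<^esub> \<rho>)))"
        using closed by (simp add: m_assoc)
      also have "\<dots> = \<sigma> \<otimes>\<^bsub>G\<^esub> (\<sigma> \<otimes>\<^bsub>G\<^esub> \<sigma> \<otimes>\<^bsub>G\<^esub> (\<sigma> \<otimes>\<^bsub>G\<^esub> \<sigma>))"
        using closed by (simp add: m_assoc \<rho>(2))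
      finally show "\<rho> \<otimes>\<^bsub>G\<^esub> \<sigma> \<otimes>\<^bsub>G\<^esub> \<rho> =
          \<sigma> \<otimes>\<^bsub>G\<^esub> (\<sigma> \<otimes>\<^bsub>G\<^esub> (\<sigma> \<otimes>\<^bsub>G\<^esub> \<rho>)) \<otimes>\<^bsub>G\<^esub> \<rho>"
        using closed \<rho>(4,5) by simp
    qed (use closed in auto)
    moreover have "ring_endo (\<psi> \<sigma>)" "ring_endo (\<psi> \<rho>)"
      using fps_action_fps_endo[OF \<psi>] closed by (auto simp: fps_endo_def)
    ultimately show ?thesis
      using closed \<rho>(2,4) fps_action_one[OF \<psi>]
      by (intro quaternion_endos.intro quaternion_endos_axioms.intro)
        (simp_all add: comp m_assoc)
  qed
  ultimately show False
    using quaternion_endos_not_simple[OF pow, of "\<psi> \<sigma>" "\<psi> \<rho>"] closed \<rho>(3) X0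
      nz[of \<rho>] nz[of "\<rho> \<otimes>\<^bsub>G\<^esub> \<sigma>"] nz[of "\<sigma> \<otimes>\<^bsub>G\<^esub> \<sigma>"] fps_action_fps_endo[OF \<psi>]
      simple_action_subdegree[OF assms(4,1)] assms(2)
    by (simp add: comp disp)
qed

end
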